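(* Let $n\ge2$ and let $D\subset\mathbb{R}^n$ be a bounded domain with piecewise smooth boundary. Let $0<\Lambda_1\le\Lambda_2\le\cdots\to+\infty$ be the eigenvalues, repeated according to multiplicity, of the Klein-Gordon operator $\mathscr{H}_{0,D}=\sqrt{-\Delta}$ restricted to $D$. Then for every $k=1,2,\ldots$, $$\frac1k\sum_{j=1}^k\Lambda_j\ \ge\ \frac{n}{n+1}\frac{2\pi}{(\omega_nVol(D))^{\frac1n}}k^{\frac1n}+\frac{1}{48(n+1)}\frac{(2\pi)^{-1}}{(\omega_nVol(D))^{-\frac1n}}\frac{Vol(D)}{Ine(D)}k^{-\frac1n}+\frac{(n-1)^2}{\mathcal{C}(n)\,n(n+1)^2}\frac{(2\pi)^{-3}}{(\omega_nVol(D))^{-\frac3n}}\left(\frac{Vol(D)}{Ine(D)}\right)^2k^{-\frac3n},$$ where $\mathcal{C}(n)=4608$ when $n\ge4$ and $\mathcal{C}(n)=6144$ when $n=2$ or $n=3$.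
   Context: A domain is a nonempty connected open set. $Vol(D)$ is the volume (Lebesgue measure) of $D$, $\omega_n$ is the volume of the unit ball of $\mathbb{R}^n$, and $Ine(D)=\min_{a\in\mathbb{R}^n}\int_D|x-a|^2\,dx$ is the moment of inertia of $D$. The Klein-Gordon operator $\mathscr{H}_{0,D}=\sqrt{-\Delta}$ restricted to $D$ is the operator $u\mapsto\mathscr{F}^{-1}\big[|\xi|\,\mathscr{F}[u\chi_D]\big]$ on $D$, where $\chi_D$ is the characteristic function of $D$ and $\mathscr{F}$ is the Fourier transform on $\mathbb{R}^n$ (with kernel $e^{-ix\cdot\xi}$). Precisely, it is the self-adjoint operator on $L^2(D)$ associated with the quadratic form $u\mapsto\int_{\mathbb{R}^n}|\xi|\,|\widehat u(\xi)|^2\,d\xi$, where $\widehat u$ is the unitary Fourier transform $\widehat u(\xi)=(2\pi)^{-n/2}\int_{\mathbb{R}^n} e^{-ix\cdot\xi}u(x)\,dx$ of the extension of $u$ by zero, with form domain the closure of $C_c^\infty(D)$ in $H^{1/2}(\mathbb{R}^n)$. Its spectrum is discrete. (This is the restricted fractional Laplacian $(-\Delta)^{\alpha/2}|_D$ with $\alpha=1$.) *)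

theory Defs
  imports "HOL-Analysis.Analysis"
begin

section \<open>Smooth functions and domains with piecewise smooth boundary\<close>

text \<open>\<open>Ck k S f\<close> is meant for open \<open>S\<close>: all iterated directional derivatives of order at most
  \<open>k\<close> exist in the Frechet sense and are continuous on \<open>S\<close>.\<close>

fun Ck :: "nat \<Rightarrow> ('a::euclidean_space) set \<Rightarrow> ('a \<Rightarrow> 'b::real_normed_vector) \<Rightarrow> bool" where
  "Ck 0 S f \<longleftrightarrow> continuous_on S f"
| "Ck (Suc k) S f \<longleftrightarrow>
     (\<forall>x\<in>S. f differentiable (at x)) \<and> (\<forall>v. Ck k S (\<lambda>x. frechet_derivative f (at x) v))"

definition smooth_on :: "('a::euclidean_space) set \<Rightarrow> ('a \<Rightarrow> 'b::real_normed_vector) \<Rightarrow> bool" where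
  "smooth_on S f \<longleftrightarrow> (\<forall>k. Ck k S f)"

definition domain :: "('a::topological_space) set \<Rightarrow> bool" where
  "domain D \<longleftrightarrow> D \<noteq> {} \<and> connected D \<and> open D"

definition smooth_hypersurface :: "('a::euclidean_space) set \<Rightarrow> bool" where
  "smooth_hypersurface N \<longleftrightarrow>
     (\<forall>p\<in>N. \<exists>U (g :: 'a \<Rightarrow> real). open U \<and> p \<in> U \<and> smooth_on U g \<and>
        (\<forall>x\<in>U. frechet_derivative g (at x) \<noteq> (\<lambda>v. 0)) \<and> N \<inter> U = {x\<in>U. g x = 0})"

text \<open>Vanishing of the \<open>s\<close>-dimensional Hausdorff measure. For \<open>s > 0\<close> no bound on the radii is
  needed, since a small sum forces all radii to be small.\<close>

definition hausdorff_null :: "nat \<Rightarrow> ('a::euclidean_space) set \<Rightarrow> bool" where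
  "hausdorff_null s Z \<longleftrightarrow>
     (\<forall>\<epsilon>>0. \<exists>(c :: nat \<Rightarrow> 'a) r. (\<forall>i. 0 \<le> r i) \<and> Z \<subseteq> (\<Union>i. cball (c i) (r i)) \<and>
        summable (\<lambda>i. r i ^ s) \<and> (\<Sum>i. r i ^ s) < \<epsilon>)"

text \<open>The boundary is the closure of finitely many connected smooth hypersurfaces, which make up
  all of it except for a singular part (edges, corners, vertices of cones, ...) of zero
  \<open>(n-1)\<close>-dimensional Hausdorff measure.\<close>

definition piecewise_smooth_boundary :: "('a::euclidean_space) set \<Rightarrow> bool" where
  "piecewise_smooth_boundary D \<longleftrightarrow>
     (\<exists>\<N>. finite \<N> \<and> (\<forall>N\<in>\<N>. smooth_hypersurface N \<and> connected N) \<and>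
        frontier D = closure (\<Union>\<N>) \<and> hausdorff_null (DIM('a) - 1) (frontier D - \<Union>\<N>))"

section \<open>Volume and moment of inertia\<close>

definition Vol :: "('a::euclidean_space) set \<Rightarrow> real" where
  "Vol D = measure lborel D"

text \<open>For bounded Borel \<open>D\<close> the infimum is attained (at the centroid of \<open>D\<close> if \<open>D\<close> has positive
  volume), so it is the minimum.\<close>

definition Ine :: "('a::euclidean_space) set \<Rightarrow> real" where
  "Ine D = (INF a. LINT x:D|lborel. (norm (x - a))\<^sup>2)"

section \<open>The restricted Klein-Gordon operator\<close>

text \<open>Elements of \<open>L\<^sup>2(D)\<close> are represented by Borel functions on the whole space that vanish
  outside \<open>D\<close>; equality in \<open>L\<^sup>2(D)\<close> is equality almost everywhere.\<close>

definition L2 :: "('a::euclidean_space) set \<Rightarrow> ('a \<Rightarrow> complex) set" where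
  "L2 D = {u. u \<in> borel_measurable borel \<and> integrable lborel (\<lambda>x. (cmod (u x))\<^sup>2) \<and>
              (\<forall>x. x \<notin> D \<longrightarrow> u x = 0)}"

definition L2_inner :: "('a::euclidean_space \<Rightarrow> complex) \<Rightarrow> ('a \<Rightarrow> complex) \<Rightarrow> complex" where
  "L2_inner u v = (LINT x|lborel. u x * cnj (v x))"

text \<open>The unitary Fourier transform, as an absolutely convergent integral. It is only applied to
  square integrable functions vanishing outside a bounded set, which are integrable.\<close>

definition fourier :: "('a::euclidean_space \<Rightarrow> complex) \<Rightarrow> 'a \<Rightarrow> complex" where
  "fourier u \<xi> = of_real ((2 * pi) powr (- real DIM('a) / 2)) *
                 (LINT x|lborel. exp (- \<i> * of_real (x \<bullet> \<xi>)) * u x)"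

definition test_functions :: "('a::euclidean_space) set \<Rightarrow> ('a \<Rightarrow> complex) set" where
  "test_functions D = {\<phi>. smooth_on UNIV \<phi> \<and> compact (closure {x. \<phi> x \<noteq> 0}) \<and>
                          closure {x. \<phi> x \<noteq> 0} \<subseteq> D}"

definition H_half_sqnorm :: "('a::euclidean_space \<Rightarrow> complex) \<Rightarrow> ennreal" where
  "H_half_sqnorm u =
     (\<integral>\<^sup>+ \<xi>. ennreal ((1 + (norm \<xi>)\<^sup>2) powr (1/2) * (cmod (fourier u \<xi>))\<^sup>2) \<partial>lborel)"

text \<open>The closure of the test functions in \<open>H\<^sup>1\<^sup>/\<^sup>2\<close>, for bounded \<open>D\<close>. A limit of test functions
  is the limit in \<open>L\<^sup>2\<close> as well and so vanishes almost everywhere outside \<open>D\<close>; hence nothing is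
  lost by taking the representative in \<open>L2 D\<close>. Its \<open>H\<^sup>1\<^sup>/\<^sup>2\<close>-norm is automatically finite.\<close>

definition form_domain :: "('a::euclidean_space) set \<Rightarrow> ('a \<Rightarrow> complex) set" where
  "form_domain D = {u \<in> L2 D. \<exists>\<phi>. (\<forall>m::nat. \<phi> m \<in> test_functions D) \<and>
                      (\<lambda>m. H_half_sqnorm (\<lambda>x. \<phi> m x - u x)) \<longlonglongrightarrow> 0}"

definition KG_form :: "('a::euclidean_space \<Rightarrow> complex) \<Rightarrow> ('a \<Rightarrow> complex) \<Rightarrow> complex" where
  "KG_form u v = (LINT \<xi>|lborel. of_real (norm \<xi>) * (fourier u \<xi> * cnj (fourier v \<xi>)))"

text \<open>The graph of the self-adjoint operator associated with the form: \<open>u\<close> is in the operator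
  domain and is mapped to \<open>f\<close>.\<close>

definition KG_operator ::
    "('a::euclidean_space) set \<Rightarrow> ('a \<Rightarrow> complex) \<Rightarrow> ('a \<Rightarrow> complex) \<Rightarrow> bool" where
  "KG_operator D u f \<longleftrightarrow> u \<in> form_domain D \<and> f \<in> L2 D \<and>
     (\<forall>v\<in>form_domain D. KG_form u v = L2_inner f v)"

definition KG_eigenspace :: "('a::euclidean_space) set \<Rightarrow> real \<Rightarrow> ('a \<Rightarrow> complex) set" where
  "KG_eigenspace D \<mu> = {u. KG_operator D u (\<lambda>x. of_real \<mu> * u x)}"

text \<open>\<open>m\<close> is the complex dimension of the eigenspace, as a space of functions modulo equality
  almost everywhere; \<open>m = 0\<close> iff \<open>\<mu>\<close> is not an eigenvalue.\<close>

definition KG_multiplicity :: "('a::euclidean_space) set \<Rightarrow> real \<Rightarrow> nat \<Rightarrow> bool" where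
  "KG_multiplicity D \<mu> m \<longleftrightarrow>
     (\<exists>\<phi>. (\<forall>i<m. \<phi> i \<in> KG_eigenspace D \<mu>) \<and>
        (\<forall>c. (AE x in lborel. (\<Sum>i<m. c i * \<phi> i x) = 0) \<longrightarrow> (\<forall>i<m. c i = 0)) \<and>
        (\<forall>u\<in>KG_eigenspace D \<mu>. \<exists>c. AE x in lborel. u x = (\<Sum>i<m. c i * \<phi> i x)))"

text \<open>\<open>\<Lambda> 1 \<le> \<Lambda> 2 \<le> \<dots>\<close> lists all eigenvalues, each as often as its multiplicity. The value \<open>\<Lambda> 0\<close>
  is irrelevant. The index sets below are finite because \<open>\<Lambda>\<close> tends to infinity.\<close>

definition KG_eigenvalues :: "('a::euclidean_space) set \<Rightarrow> (nat \<Rightarrow> real) \<Rightarrow> bool" where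
  "KG_eigenvalues D \<Lambda> \<longleftrightarrow> 0 < \<Lambda> 1 \<and> mono_on {1..} \<Lambda> \<and> filterlim \<Lambda> at_top sequentially \<and>
     (\<forall>\<mu>. KG_multiplicity D \<mu> (card {j. 1 \<le> j \<and> \<Lambda> j = \<mu>}))"

definition C_const :: "nat \<Rightarrow> real" where
  "C_const n = (if n = 2 \<or> n = 3 then 6144 else 4608)"

end

theory Submission
  imports Defs "HOL-Probability.Characteristic_Functions"
begin

text \<open>
  Let \<open>F = \<Sum>\<^bsub>j\<le>k\<^esub> |fourier u\<^sub>j|\<^sup>2\<close> be the density in Fourier space of the first \<open>k\<close> orthonormal eigenfunctions.
  Bessel's inequality for plane waves restricted to \<open>D\<close> gives \<open>0 \<le> F \<le> M = (2 \<pi>)\<^sup>-\<^sup>n Vol(D)\<close>, and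
  applied to differences of plane waves centred at \<open>a\<close> it shows that \<open>F\<close> is Lipschitz with constant
  \<open>\<rho> = 2 (2 \<pi>)\<^sup>-\<^sup>n sqrt (Vol(D) Ine(D))\<close>. By Plancherel \<open>\<integral> F = k\<close>, while \<open>\<integral> |\<xi>| F\<close> is the sum of the
  eigenvalues. Minimising \<open>\<integral> |\<xi>| F\<close> under \<open>0 \<le> F \<le> M\<close> alone yields the leading term. Since \<open>F\<close> cannot
  jump across the sphere of radius \<open>R\<close> bounding the minimiser, comparing \<open>F(\<xi>)\<close> with \<open>F(l \<xi>)\<close> for a
  single dilation \<open>l > 1\<close> already gains more than the two correction terms; no rearrangement of \<open>F\<close>
  is needed.
\<close>

section \<open>Radial integrals and the comparison argument\<close>

text \<open>Put \<open>x = M / (\<rho> * R)\<close>, where the ball of radius \<open>R\<close>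
  filled at density \<open>M\<close> has mass \<open>k\<close>. The comparison gains
  \<open>R / (n + 1) * (x^2 / 12 + x^4 / 288)\<close> per unit of mass. Since
  \<open>x^2 = Vol D / (4 * Ine D * R^2)\<close>, the two summands are the correction terms with 48
  = 4 * 12 and 4608 = 16 * 288. The third coefficient is thus obtained as
  \<open>1 / (4608 * (n + 1))\<close> in every dimension, and the stated one is smaller because
  \<open>(n - 1)^2 \<le> n * (n + 1)\<close>. No single dilation can give such a gain for all
  \<open>x\<close>: what it gains stays bounded as \<open>l\<close> grows, while the polynomial does
  not. Hence \<open>x \<le> 2 / 3\<close> has to be secured, and it comes from the fact that a set
  of given volume cannot have a small moment of inertia. On the analytic side the delicate half of
  Plancherel's identity is the lower bound for the norm of \<open>fourier u\<close>, because the
  mass of \<open>F\<close> must not drop below \<open>k\<close>. On the spectral side the data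
  consist of multiplicities only, so an orthonormal system indexed like \<open>\<Lambda>\<close> has
  to be assembled from the eigenspaces.\<close>

lemma lborel_affine_integral:
  fixes f :: "'a::euclidean_space \<Rightarrow> 'b::{banach, second_countable_topology}"
  assumes "c \<noteq> 0" and f: "integrable lborel f"
  shows "integrable lborel (\<lambda>x. f (t + c *\<^sub>R x))"
    and "(LINT x|lborel. f (t + c *\<^sub>R x)) = (1 / \<bar>c\<bar> ^ DIM('a)) *\<^sub>R (LINT x|lborel. f x)"
proof -
  have eq: "lborel = density (distr lborel borel (\<lambda>x::'a. t + c *\<^sub>R x)) (\<lambda>_. ennreal (\<bar>c\<bar> ^ DIM('a)))"
    using lborel_affine[of c t] assms(1) by (simp add: ennreal_power)
  have m[measurable]: "f \<in> borel_measurable borel"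
    using f by simp
  have "integrable (density (distr lborel borel (\<lambda>x::'a. t + c *\<^sub>R x)) (\<lambda>_. ennreal (\<bar>c\<bar> ^ DIM('a)))) f"
    using f eq by simp
  then have "integrable lborel (\<lambda>x. \<bar>c\<bar> ^ DIM('a) *\<^sub>R f (t + c *\<^sub>R x))"
    by (simp add: integrable_density integrable_distr_eq)
  then show "integrable lborel (\<lambda>x. f (t + c *\<^sub>R x))"
    using integrable_scaleR_right[of "1 / \<bar>c\<bar> ^ DIM('a)"] assms(1) by fastforce
  have "(LINT x|lborel. f x) =
      integral\<^sup>L (density (distr lborel borel (\<lambda>x::'a. t + c *\<^sub>R x)) (\<lambda>_. ennreal (\<bar>c\<bar> ^ DIM('a)))) f"
    using eq by simp
  also have "\<dots> = \<bar>c\<bar> ^ DIM('a) *\<^sub>R (LINT x|lborel. f (t + c *\<^sub>R x))"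
    by (simp add: integral_density integral_distr)
  finally show "(LINT x|lborel. f (t + c *\<^sub>R x)) = (1 / \<bar>c\<bar> ^ DIM('a)) *\<^sub>R (LINT x|lborel. f x)"
    using assms(1) by simp
qed

lemma emeasure_ball_unit_ball_vol:
  fixes a :: "'a::euclidean_space"
  assumes "r \<ge> 0"
  shows "emeasure lborel (ball a r) = ennreal (unit_ball_vol DIM('a) * r ^ DIM('a))"
  using emeasure_ball[OF assms, of a] by simp

text \<open>Layer cake: the height of the cone at \<open>x\<close> is the length of the interval of
  all \<open>r\<close> with \<open>norm x < r \<le> c\<close>, so Tonelli's theorem reduces the
  integral to that of ball volumes over \<open>r\<close> in \<open>{0..c}\<close>.\<close>

lemma cone_integral:
  fixes c :: real
  assumes "c \<ge> 0"
  shows "integrable lborel (\<lambda>x::'a::euclidean_space. max 0 (c - norm x))"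
    and "(LINT x::'a|lborel. max 0 (c - norm x)) =
      unit_ball_vol DIM('a) * c ^ (DIM('a) + 1) / (DIM('a) + 1)"
proof -
  let ?w = "unit_ball_vol DIM('a)" and ?n = "DIM('a)"
  have "(\<integral>\<^sup>+x. ennreal (max 0 (c - norm (x::'a))) \<partial>lborel)
      = (\<integral>\<^sup>+x. (\<integral>\<^sup>+r. indicator {0..c} r * indicator {y::'a \<times> real. norm (fst y) < snd y} (x, r) \<partial>lborel) \<partial>lborel)"
  proof (rule nn_integral_cong)
    fix x :: 'a
    have "ennreal (max 0 (c - norm x)) = (\<integral>\<^sup>+r. indicator {norm x<..c} r \<partial>lborel)"
      by (cases "norm x \<le> c") (auto simp: max_def)
    also have "\<dots> = (\<integral>\<^sup>+r. indicator {0..c} r * indicator {y::'a \<times> real. norm (fst y) < snd y} (x, r) \<partial>lborel)"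
      by (intro nn_integral_cong) (auto simp: indicator_def intro: order_trans[OF norm_ge_zero less_imp_le])
    finally show "ennreal (max 0 (c - norm x)) = \<dots>" .
  qed
  also have "\<dots> = (\<integral>\<^sup>+r. (\<integral>\<^sup>+x. indicator {0..c} r * indicator {y::'a \<times> real. norm (fst y) < snd y} (x, r) \<partial>lborel) \<partial>lborel)"
    by (rule lborel_pair.Fubini') measurable
  also have "\<dots> = (\<integral>\<^sup>+r. ennreal (?w * r ^ ?n) * indicator {0..c} r \<partial>lborel)"
  proof (rule nn_integral_cong)
    fix r :: real
    have "(\<integral>\<^sup>+x. indicator {0..c} r * indicator {y::'a \<times> real. norm (fst y) < snd y} (x, r) \<partial>lborel)
       = (\<integral>\<^sup>+x. indicator {0..c} r * indicator (ball (0::'a) r) x \<partial>lborel)"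
      by (intro nn_integral_cong) (auto simp: indicator_def)
    also have "\<dots> = indicator {0..c} r * emeasure lborel (ball (0::'a) r)"
      by (subst nn_integral_cmult_indicator) auto
    also have "\<dots> = ennreal (?w * r ^ ?n) * indicator {0..c} r"
      by (cases "r \<in> {0..c}") (auto simp: emeasure_ball_unit_ball_vol)
    finally show "(\<integral>\<^sup>+x. indicator {0..c} r * indicator {y::'a \<times> real. norm (fst y) < snd y} (x, r) \<partial>lborel)
       = ennreal (?w * r ^ ?n) * indicator {0..c} r" .
  qed
  also have "\<dots> = ennreal (?w / (?n + 1) * c ^ (?n + 1) - ?w / (?n + 1) * 0 ^ (?n + 1))"
  proof (rule nn_integral_FTC_Icc)
    fix r :: real
    have "((\<lambda>r. r ^ (?n + 1)) has_real_derivative real (?n + 1) * r ^ ?n) (at r)"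
      by (rule derivative_eq_intros | simp)+
    then have "((\<lambda>r. ?w / real (?n + 1) * r ^ (?n + 1)) has_real_derivative ?w / real (?n + 1) * (real (?n + 1) * r ^ ?n)) (at r)"
      by (rule DERIV_cmult)
    moreover have "?w / real (?n + 1) * (real (?n + 1) * r ^ ?n) = ?w * r ^ ?n"
      by (simp del: of_nat_add of_nat_Suc)
    ultimately have "((\<lambda>r. ?w / real (?n + 1) * r ^ (?n + 1)) has_real_derivative ?w * r ^ ?n) (at r)"
      by (simp only:)
    then show "((\<lambda>r. ?w / (?n + 1) * r ^ (?n + 1)) has_real_derivative ?w * r ^ ?n) (at r)"
      by simp
  qed (use assms in auto)
  finally have *: "(\<integral>\<^sup>+x. ennreal (max 0 (c - norm (x::'a))) \<partial>lborel) = ennreal (?w * c ^ (?n + 1) / (?n + 1))"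
    by simp
  show "integrable lborel (\<lambda>x::'a. max 0 (c - norm x))"
    by (rule integrableI_nonneg) (simp_all only: * ennreal_less_top infinity_ennreal_def, auto)
  show "(LINT x::'a|lborel. max 0 (c - norm x)) = ?w * c ^ (?n + 1) / (?n + 1)"
    using assms by (subst integral_eq_nn_integral) (simp_all only: *, auto)
qed

text \<open>The left-hand side increases with \<open>n\<close>, and the right-hand side is its value at \<open>n = 2\<close>.\<close>

lemma power_gap_ge_dim2:
  fixes l :: real
  assumes "l \<ge> 1" "n \<ge> 2"
  shows "1 + (1 / l) ^ n - 2 * (2 / (1 + l)) ^ n \<ge> (l - 1)\<^sup>2 * (l\<^sup>2 + 4 * l + 1) / (l\<^sup>2 * (1 + l)\<^sup>2)"
  using assms(2)
proof (induction n rule: dec_induct)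
  case base
  show ?case using assms(1)
  proof -
    have "1 + (1 / l)\<^sup>2 - 2 * (2 / (1 + l))\<^sup>2 = ((l\<^sup>2 + 1) * (1 + l)\<^sup>2 - 8 * l\<^sup>2) / (l\<^sup>2 * (1 + l)\<^sup>2)"
      using assms(1) by (simp add: divide_simps)
    also have "(l\<^sup>2 + 1) * (1 + l)\<^sup>2 - 8 * l\<^sup>2 = (l - 1)\<^sup>2 * (l\<^sup>2 + 4 * l + 1)"
      by algebra
    finally show ?thesis by simp
  qed
next
  case (step n)
  let ?a = "1 / l" and ?b = "2 / (1 + l)"
  have ab: "?a ^ n \<le> ?b ^ n"
    using assms(1) by (intro power_mono) (auto simp: field_simps)
  \<comment> \<open>Passing from \<open>n\<close> to \<open>n + 1\<close> adds
    \<open>2 * b^n * (1 - b) - a^n * (1 - a)\<close>. Here \<open>1 - a = (l - 1) * a\<close> and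
    \<open>2 * (1 - b) = (l - 1) * b\<close>, so \<open>a \<le> b\<close> makes the increment
    nonnegative.\<close>
  have "?a ^ n * (1 - ?a) \<le> ?b ^ n * (1 - ?a)"
    using ab assms(1) by (intro mult_right_mono) auto
  also have "\<dots> \<le> ?b ^ n * (2 * (1 - ?b))"
  proof (rule mult_left_mono)
    have "1 - ?a = (l - 1) / l" "2 * (1 - ?b) = (l - 1) * 2 / (1 + l)"
      using assms(1) by (auto simp: field_simps)
    moreover have "1 / l \<le> 2 / (1 + l)" using assms(1) by (simp add: field_simps)
    then have "(l - 1) * (1 / l) \<le> (l - 1) * (2 / (1 + l))"
      using assms(1) by (intro mult_left_mono) auto
    ultimately show "1 - ?a \<le> 2 * (1 - ?b)" by simp
  qed (use assms(1) in auto)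
  finally show ?case using step.IH by (simp add: algebra_simps)
qed

text \<open>This converts the gap for \<open>l = 1 + x / 2\<close> into the polynomial of the final
  bound. The factor 2 on the right pays for the half of the gain that the Lipschitz estimate gives
  away.\<close>

lemma power_gap_lower:
  fixes x :: real
  assumes "0 \<le> x" "x \<le> 2 / 3" "n \<ge> 2"
  shows "1 + (1 / (1 + x / 2)) ^ n - 2 * (2 / (2 + x / 2)) ^ n \<ge> 2 * (x\<^sup>2 / 12 + x ^ 4 / 288)"
proof -
  define l where "l = 1 + x / 2"
  have l: "1 \<le> l" "l \<le> 4 / 3" and x: "x = 2 * (l - 1)" using assms by (auto simp: l_def)
  have l24: "l\<^sup>2 * (1 + l)\<^sup>2 > 0" using l by auto
  have x2: "x\<^sup>2 \<le> 4 / 9" using power_mono[OF assms(2,1), of 2] by (simp add: power_divide)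
  have "x ^ 4 = x\<^sup>2 * x\<^sup>2" by (simp add: power_numeral_reduce)
  also have "\<dots> \<le> x\<^sup>2 * (4 / 9)" using x2 by (intro mult_left_mono) auto
  \<comment> \<open>By \<open>x \<le> 2 / 3\<close> the quartic term is absorbed: 2 * (1/12 +
    (4/9)/288) = 55/324, which becomes 55/81 in terms of \<open>l - 1 = x / 2\<close>.\<close>
  finally have "2 * (x\<^sup>2 / 12 + x ^ 4 / 288) \<le> 55 / 324 * x\<^sup>2" by simp
  also have "\<dots> = (l - 1)\<^sup>2 * (55 / 81)" by (simp add: x power2_eq_square algebra_simps)
  also have "\<dots> \<le> (l - 1)\<^sup>2 * ((l\<^sup>2 + 4 * l + 1) / (l\<^sup>2 * (1 + l)\<^sup>2))"
  proof (rule mult_left_mono)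
    have "l\<^sup>2 \<le> 16 / 9" using power_mono[OF l(2), of 2] l by (simp add: power_divide)
    then have "l * (1 + l) \<le> 28 / 9" using l by (simp add: algebra_simps power2_eq_square)
    \<comment> \<open>One of the two factors \<open>l * (1 + l)\<close> is replaced by its maximum
      28/9, attained at \<open>l = 4 / 3\<close>; this leaves a quadratic inequality in
      \<open>l\<close>.\<close>
    then have "(l * (1 + l)) * (l * (1 + l)) \<le> 28 / 9 * (l * (1 + l))"
      using l by (intro mult_right_mono) auto
    then have "l\<^sup>2 * (1 + l)\<^sup>2 \<le> 28 / 9 * (l * (1 + l))" by (simp add: power2_eq_square algebra_simps)
    moreover have "55 / 81 * (28 / 9 * (l * (1 + l))) \<le> l\<^sup>2 + 4 * l + 1"
      using \<open>l\<^sup>2 \<le> 16 / 9\<close> l by (simp add: algebra_simps power2_eq_square)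
    ultimately have "55 / 81 * (l\<^sup>2 * (1 + l)\<^sup>2) \<le> l\<^sup>2 + 4 * l + 1" by linarith
    then show "55 / 81 \<le> (l\<^sup>2 + 4 * l + 1) / (l\<^sup>2 * (1 + l)\<^sup>2)"
      using l24 by (subst pos_le_divide_eq) auto
  qed auto
  also have "\<dots> = (l - 1)\<^sup>2 * (l\<^sup>2 + 4 * l + 1) / (l\<^sup>2 * (1 + l)\<^sup>2)" by simp
  also have "\<dots> \<le> 1 + (1 / l) ^ n - 2 * (2 / (1 + l)) ^ n"
    by (rule power_gap_ge_dim2[OF l(1) assms(3)])
  finally show ?thesis by (simp add: l_def)
qed

text \<open>The hat is piecewise linear in \<open>s\<close>: zero up to \<open>R / l\<close>, then
  of slope \<open>l\<close> up to the crossing point \<open>2 * R / (1 + l)\<close> of the two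
  lines, then of slope -1 down to zero at \<open>R\<close>. The coefficients of the three cones are
  the jumps \<open>l\<close>, \<open>-(1 + l)\<close> and 1 of the slope.\<close>

lemma hat_eq_cones:
  fixes l R s :: real
  assumes "l \<ge> 1" "R > 0" "s \<ge> 0"
  shows "max 0 (min (R - s) (l * s - R)) =
    l * max 0 (R / l - s) - (1 + l) * max 0 (2 * R / (1 + l) - s) + max 0 (R - s)"
proof -
  have 1: "R / l \<le> 2 * R / (1 + l)" "2 * R / (1 + l) \<le> R"
    using assms mult_right_mono[of 1 l R] by (auto simp: field_simps)
  have e: "l * (R / l - s) = R - l * s" "(1 + l) * (2 * R / (1 + l) - s) = 2 * R - (1 + l) * s"
    using assms by (auto simp: field_simps)
  have s1: "s \<le> R / l \<longleftrightarrow> l * s \<le> R" "s \<le> 2 * R / (1 + l) \<longleftrightarrow> (1 + l) * s \<le> 2 * R"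
    using assms by (auto simp: field_simps)
  consider "s \<le> R / l" | "R / l < s" "s \<le> 2 * R / (1 + l)" | "2 * R / (1 + l) < s" "s \<le> R" | "s > R"
    by linarith
  then show ?thesis
  proof cases
    case 1
    then show ?thesis using \<open>R / l \<le> 2 * R / (1 + l)\<close> \<open>2 * R / (1 + l) \<le> R\<close> s1 e
      by (auto simp: max_def min_def algebra_simps)
  next
    case 2
    then show ?thesis using \<open>2 * R / (1 + l) \<le> R\<close> s1 e
      by (auto simp: max_def min_def algebra_simps)
  next
    case 3
    then show ?thesis using 1 s1 e
      by (auto simp: max_def min_def algebra_simps)
  next
    case 4
    then show ?thesis using 1 s1 e
      by (auto simp: max_def min_def algebra_simps)
  qed
qed

lemma hat_integral:
  fixes l R :: real
  assumes "l \<ge> 1" "R > 0"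
  shows "integrable lborel (\<lambda>x::'a::euclidean_space. max 0 (min (R - norm x) (l * norm x - R)))"
    and "(LINT x::'a|lborel. max 0 (min (R - norm x) (l * norm x - R))) =
      unit_ball_vol DIM('a) * R ^ (DIM('a) + 1) / (DIM('a) + 1) *
        (1 + (1 / l) ^ DIM('a) - 2 * (2 / (1 + l)) ^ DIM('a))"
proof -
  have eq: "(\<lambda>x::'a. max 0 (min (R - norm x) (l * norm x - R))) =
    (\<lambda>x. l * max 0 (R / l - norm x) - (1 + l) * max 0 (2 * R / (1 + l) - norm x) + max 0 (R - norm x))"
    using assms by (intro ext hat_eq_cones) auto
  have i: "integrable lborel (\<lambda>x::'a. max 0 (R / l - norm x))"
    "integrable lborel (\<lambda>x::'a. max 0 (2 * R / (1 + l) - norm x))"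
    "integrable lborel (\<lambda>x::'a. max 0 (R - norm x))"
    using assms by (auto intro!: cone_integral)
  show "integrable lborel (\<lambda>x::'a. max 0 (min (R - norm x) (l * norm x - R)))"
    unfolding eq using i by auto
  show "(LINT x::'a|lborel. max 0 (min (R - norm x) (l * norm x - R))) =
      unit_ball_vol DIM('a) * R ^ (DIM('a) + 1) / (DIM('a) + 1) *
        (1 + (1 / l) ^ DIM('a) - 2 * (2 / (1 + l)) ^ DIM('a))"
  proof -
    have "l * (R / l) ^ (DIM('a) + 1) = R ^ (DIM('a) + 1) * (1 / l) ^ DIM('a)"
      "(1 + l) * (2 * R / (1 + l)) ^ (DIM('a) + 1) = R ^ (DIM('a) + 1) * (2 * (2 / (1 + l)) ^ DIM('a))"
      using assms by (auto simp: power_divide power_mult_distrib)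
    moreover have "(LINT x::'a|lborel. max 0 (min (R - norm x) (l * norm x - R))) =
      unit_ball_vol DIM('a) / (DIM('a) + 1) *
        (l * (R / l) ^ (DIM('a) + 1) - (1 + l) * (2 * R / (1 + l)) ^ (DIM('a) + 1) + R ^ (DIM('a) + 1))"
    proof -
      have nn: "R / l \<ge> 0" "2 * R / (1 + l) \<ge> 0" "R \<ge> 0" using assms by auto
      have "(LINT x::'a|lborel. max 0 (min (R - norm x) (l * norm x - R))) =
        l * (LINT x::'a|lborel. max 0 (R / l - norm x)) - (1 + l) * (LINT x::'a|lborel. max 0 (2 * R / (1 + l) - norm x))
          + (LINT x::'a|lborel. max 0 (R - norm x))"
        unfolding eq using i by simp
      then show ?thesis
        unfolding cone_integral(2)[OF nn(1)] cone_integral(2)[OF nn(2)] cone_integral(2)[OF nn(3)]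
        by (simp add: diff_divide_distrib add_divide_distrib right_diff_distrib distrib_left mult_ac del: power_Suc)
    qed

    ultimately show ?thesis by (simp only:) (simp add: algebra_simps add_divide_distrib)
  qed
qed

text \<open>Without the Lipschitz condition the minimiser of \<open>\<integral> |\<xi>| F\<close> would be \<open>M\<close> times the indicator of
  the ball of radius \<open>R\<close>. The excess over that value is estimated by comparing \<open>F\<close> at a point \<open>\<xi>\<close>
  just inside the sphere with its value at \<open>l \<xi>\<close> just outside, where \<open>l = 1 + x / 2\<close>: by the
  Lipschitz condition these differ by at most \<open>M / 2\<close>.\<close>

lemma lipschitz_bathtub:
  fixes F :: "'a::euclidean_space \<Rightarrow> real"
  assumes n: "DIM('a) \<ge> 2"
    and F0: "\<And>x. 0 \<le> F x" and FM: "\<And>x. F x \<le> M"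
    and lip: "\<And>x y. \<bar>F x - F y\<bar> \<le> \<rho> * norm (x - y)"
    and int: "integrable lborel F" "integrable lborel (\<lambda>x. norm x * F x)"
    and mass: "unit_ball_vol DIM('a) * M * R ^ DIM('a) \<le> (LINT x|lborel. F x)"
    and R: "R > 0" and x: "0 \<le> x" "x \<le> 2 / 3" and M: "M = \<rho> * (x * R)" "M \<ge> 0" "\<rho> \<ge> 0"
  shows "unit_ball_vol DIM('a) * M * R ^ DIM('a) *
      (real DIM('a) / (DIM('a) + 1) * R + R / (DIM('a) + 1) * (x\<^sup>2 / 12 + x ^ 4 / 288))
    \<le> (LINT x|lborel. norm x * F x)"
proof -
  define l where "l = 1 + x / 2"
  \<comment> \<open>\<open>g\<close> is the largest weight that can be charged both to
    \<open>y\<close> inside the sphere, whose depth is \<open>R - norm y\<close>, and to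
    \<open>l *\<^sub>R y\<close> outside it, whose excess is \<open>l * norm y - R\<close>.\<close>
  define g where "g = (\<lambda>y::'a. max 0 (min (R - norm y) (l * norm y - R)))"
  define q where "q = 1 + (1 / l) ^ DIM('a) - 2 * (2 / (1 + l)) ^ DIM('a)"
  define c where "c = unit_ball_vol DIM('a) * R ^ (DIM('a) + 1) / (DIM('a) + 1)"
  let ?p = "\<lambda>y::'a. max 0 (norm y - R)" and ?m = "\<lambda>y::'a. max 0 (R - norm y)"
  have l: "l \<ge> 1" using x by (simp add: l_def)
  have Fm[measurable]: "F \<in> borel_measurable borel" using int(1) by simp
  have g_int: "integrable lborel g" "(LINT y|lborel. g y) = c * q"
    unfolding g_def c_def q_def using hat_integral[OF l R] by auto
  have gm[measurable]: "g \<in> borel_measurable borel" using g_int by simp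
  have m_int: "integrable lborel ?m" "(LINT y|lborel. ?m y) = c"
    unfolding c_def using cone_integral[of R, where 'a='a] R by auto
  have g0: "0 \<le> g y" for y by (simp add: g_def)
  have bdd: "integrable lborel (\<lambda>y. h y * G y)"
    if "integrable lborel h" "G \<in> borel_measurable borel" "\<And>y. 0 \<le> G y" "\<And>y. G y \<le> M" for h G :: "'a \<Rightarrow> real"
  proof (rule Bochner_Integration.integrable_bound[OF integrable_mult_left[OF that(1), of M]])
    show "AE y in lborel. norm (h y * G y) \<le> norm (h y * M)"
      using that(3,4) \<open>M \<ge> 0\<close> by (intro AE_I2) (simp add: abs_mult mult_left_mono)
  qed (use that in auto)
  have p_int: "integrable lborel (\<lambda>y. ?p y * F y)"
    by (rule Bochner_Integration.integrable_bound[OF int(2)])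
       (use F0 R in \<open>auto simp: abs_mult intro!: mult_right_mono\<close>)
  have mF: "integrable lborel (\<lambda>y. ?m y * F y)" by (rule bdd) (use m_int F0 FM in auto)
  have gF: "integrable lborel (\<lambda>y. g y * F y)" by (rule bdd) (use g_int F0 FM in auto)
  have gFl: "integrable lborel (\<lambda>y. g y * F (l *\<^sub>R y))" by (rule bdd) (use g_int F0 FM in auto)
  \<comment> \<open>The weight at \<open>y\<close> is at most the excess of
    \<open>l *\<^sub>R y\<close>, and undoing the dilation contributes the factor
    \<open>1 / l^n \<le> 1\<close>.\<close>
  have step1: "(LINT y|lborel. g y * F (l *\<^sub>R y)) \<le> (LINT y|lborel. ?p y * F y)"
  proof -
    let ?h = "\<lambda>y. ?p y * F y"
    have h0: "0 \<le> (LINT y|lborel. ?h y)" using F0 by (intro integral_nonneg_AE) auto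
    have hl: "integrable lborel (\<lambda>y. ?h (l *\<^sub>R y))"
      "(LINT y|lborel. ?h (l *\<^sub>R y)) = (1 / l ^ DIM('a)) *\<^sub>R (LINT y|lborel. ?h y)"
      using lborel_affine_integral[OF _ p_int, of l 0] l by auto
    have "(LINT y|lborel. g y * F (l *\<^sub>R y)) \<le> (LINT y|lborel. ?h (l *\<^sub>R y))"
    proof (rule integral_mono[OF gFl hl(1)])
      fix y
      have "g y \<le> ?p (l *\<^sub>R y)" using l by (auto simp: g_def)
      then show "g y * F (l *\<^sub>R y) \<le> ?h (l *\<^sub>R y)" using F0 by (intro mult_right_mono) auto
    qed
    also have "\<dots> \<le> 1 * (LINT y|lborel. ?h y)"
      unfolding hl(2) real_scaleR_def using l h0 by (intro mult_right_mono) auto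
    finally show ?thesis by simp
  qed
  have step2: "(LINT y|lborel. g y * F y) - (LINT y|lborel. g y * F (l *\<^sub>R y)) \<le> (M / 2) * (c * q)"
  proof -
    have "(LINT y|lborel. g y * F y) - (LINT y|lborel. g y * F (l *\<^sub>R y)) =
        (LINT y|lborel. g y * F y - g y * F (l *\<^sub>R y))"
      using gF gFl by simp
    also have "\<dots> \<le> (LINT y|lborel. M / 2 * g y)"
    proof (rule integral_mono)
      fix y :: 'a
      show "g y * F y - g y * F (l *\<^sub>R y) \<le> M / 2 * g y"
      proof (cases "norm y \<le> R")
        case True
        have "F y - F (l *\<^sub>R y) \<le> \<rho> * norm (y - l *\<^sub>R y)" using lip[of y "l *\<^sub>R y"] by linarith
        also have "y - l *\<^sub>R y = (- x / 2) *\<^sub>R y" by (simp add: l_def algebra_simps)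
        also have "norm \<dots> = x / 2 * norm y" using x by simp
        also have "\<rho> * (x / 2 * norm y) \<le> \<rho> * (x / 2 * R)"
          using True x M by (intro mult_left_mono) auto
        also have "\<dots> = M / 2" using M by simp
        finally have "g y * (F y - F (l *\<^sub>R y)) \<le> g y * (M / 2)" using g0 by (intro mult_left_mono)
        then show ?thesis by (simp add: algebra_simps)
      qed (simp add: g_def)
    qed (use gF gFl g_int in auto)
    also have "\<dots> = (M / 2) * (c * q)" using g_int by simp
    finally show ?thesis .
  qed
  \<comment> \<open>The part \<open>?m y - g y\<close> of the inner weight that is not paired is
    nonnegative and is estimated by \<open>F \<le> M\<close>.\<close>
  have step3: "(LINT y|lborel. ?m y * F y) - (LINT y|lborel. g y * F y) \<le> M * c - M * (c * q)"
  proof -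
    have "(LINT y|lborel. ?m y * F y) - (LINT y|lborel. g y * F y) = (LINT y|lborel. ?m y * F y - g y * F y)"
      using mF gF by simp
    also have "\<dots> \<le> (LINT y|lborel. M * ?m y - M * g y)"
    proof (rule integral_mono)
      fix y :: 'a
      have "(?m y - g y) * F y \<le> (?m y - g y) * M"
        using FM by (intro mult_left_mono) (auto simp: g_def)
      then show "?m y * F y - g y * F y \<le> M * ?m y - M * g y" by (simp add: algebra_simps)
    qed (use mF gF m_int g_int in auto)
    also have "\<dots> = M * c - M * (c * q)" using m_int g_int by simp
    finally show ?thesis .
  qed
  \<comment> \<open>Splitting \<open>norm y\<close> as \<open>R + ?p y - ?m y\<close> measures the
    moment relative to the sphere. When the three estimates are combined, the unknown integral of
    \<open>g y * F y\<close> cancels; what remains is the loss \<open>M * c\<close> of the full ball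
    and the gain \<open>M / 2 * (c * q)\<close>.\<close>
  have "(LINT y|lborel. norm y * F y) = (LINT y|lborel. R * F y + ?p y * F y - ?m y * F y)"
    by (intro Bochner_Integration.integral_cong) (auto simp: max_def algebra_simps)
  also have "\<dots> = R * (LINT y|lborel. F y) + (LINT y|lborel. ?p y * F y) - (LINT y|lborel. ?m y * F y)"
    using int p_int mF by simp
  finally have A: "(LINT y|lborel. norm y * F y) \<ge> R * (LINT y|lborel. F y) - M * c + M / 2 * (c * q)"
    using step1 step2 step3 by (simp add: algebra_simps)
  have "R * (LINT y|lborel. F y) \<ge> R * (unit_ball_vol DIM('a) * M * R ^ DIM('a))"
    using mass R by (intro mult_left_mono) linarith+
  moreover have "R * (unit_ball_vol DIM('a) * M * R ^ DIM('a)) = (real DIM('a) + 1) * (M * c)"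
    unfolding c_def by (simp add: field_simps)
  moreover have "c \<ge> 0" using R by (simp add: c_def)
  moreover have "q \<ge> 2 * (x\<^sup>2 / 12 + x ^ 4 / 288)"
    using power_gap_lower[OF x n] by (simp add: q_def l_def)
  then have "M * c / 2 * q \<ge> M * c / 2 * (2 * (x\<^sup>2 / 12 + x ^ 4 / 288))"
    using \<open>c \<ge> 0\<close> M by (intro mult_left_mono) auto
  ultimately have B: "(LINT y|lborel. norm y * F y) \<ge> real DIM('a) * (M * c) + M * c * (x\<^sup>2 / 12 + x ^ 4 / 288)"
    using A by (simp add: algebra_simps)
  have "M * c = unit_ball_vol DIM('a) * M * R ^ DIM('a) * (R / (DIM('a) + 1))"
    by (simp add: c_def)
  then have "real DIM('a) * (M * c) + M * c * (x\<^sup>2 / 12 + x ^ 4 / 288) =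
    unit_ball_vol DIM('a) * M * R ^ DIM('a) *
      (real DIM('a) / (DIM('a) + 1) * R + R / (DIM('a) + 1) * (x\<^sup>2 / 12 + x ^ 4 / 288))"
    by (simp only:) (simp add: algebra_simps)
  with B show ?thesis by (simp only:)
qed

section \<open>Plancherel's identity\<close>

lemma borel_measurable_cnj [measurable]: "cnj \<in> borel_measurable borel"
  by (intro borel_measurable_continuous_onI continuous_intros)

abbreviation wave :: "real \<Rightarrow> complex" where
  "wave y \<equiv> exp (- \<i> * of_real y)"

lemma norm_wave [simp]: "cmod (wave y) = 1"
  by (simp add: norm_exp_eq_Re)

lemma integrable_wave_mult:
  fixes u :: "'a::euclidean_space \<Rightarrow> complex"
  assumes "integrable lborel u" and [measurable]: "h \<in> borel_measurable borel"
  shows "integrable lborel (\<lambda>x. wave (h x) * u x)"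
  by (rule Bochner_Integration.integrable_bound[OF assms(1)]) (use assms(1) in \<open>auto simp: norm_mult\<close>)

definition gauss :: "'a::euclidean_space \<Rightarrow> real" where
  "gauss x = (2 * pi) powr (- real DIM('a) / 2) * exp (- (norm x)\<^sup>2 / 2)"

lemma gauss_pos: "gauss x > 0"
  by (simp add: gauss_def)

lemma gauss_measurable [measurable]: "gauss \<in> borel_measurable borel"
  unfolding gauss_def[abs_def] by measurable

lemma gauss_eq_prod:
  fixes x :: "'a::euclidean_space"
  shows "gauss x = (\<Prod>b\<in>Basis. std_normal_density (x \<bullet> b))"
proof -
  have "(norm x)\<^sup>2 = (\<Sum>b\<in>Basis. (x \<bullet> b)\<^sup>2)"
    by (subst power2_norm_eq_inner, subst euclidean_inner) (simp add: power2_eq_square)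
  then have "exp (- (norm x)\<^sup>2 / 2) = (\<Prod>b\<in>Basis. exp (- (x \<bullet> b)\<^sup>2 / 2))"
    by (simp add: exp_sum[symmetric] sum_negf sum_divide_distrib)
  moreover have "(1 / sqrt (2 * pi)) ^ DIM('a) = (2 * pi) powr (- real DIM('a) / 2)"
  proof -
    have "1 / sqrt (2 * pi) = (2 * pi) powr (- (1 / 2))"
      by (simp only: powr_minus_divide powr_half_sqrt[of "2 * pi"] pi_ge_zero mult_nonneg_nonneg zero_le_numeral)
    moreover have "((2 * pi) powr (- (1 / 2))) ^ DIM('a) = ((2 * pi) powr (- (1 / 2))) powr real DIM('a)"
      by (subst powr_realpow) auto
    ultimately show ?thesis by (simp only: powr_powr) simp
  qed
  ultimately show ?thesis
    by (simp only: gauss_def std_normal_density_def prod.distrib prod_constant)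
qed

text \<open>In orthonormal coordinates the integrand is a product, and each factor integrates to the
  characteristic function of the standard normal distribution at
  \<open>- (t \<bullet> b)\<close>.\<close>

lemma gauss_fourier:
  fixes t :: "'a::euclidean_space"
  shows "integrable lborel (\<lambda>x::'a. gauss x)"
    and "(LINT x|lborel. wave (x \<bullet> t) * gauss x) = of_real (exp (- (norm t)\<^sup>2 / 2))"
proof -
  interpret product_sigma_finite "\<lambda>_::'a. lborel :: real measure" ..
  define f where "f = (\<lambda>(b::'a) y. wave (y * (t \<bullet> b)) * of_real (std_normal_density y))"
  have f_int: "integrable lborel (f b)" for b
    unfolding f_def by (intro integrable_wave_mult integrable_of_real) auto
  have f_val: "(LINT y|lborel. f b y) = of_real (exp (- (t \<bullet> b)\<^sup>2 / 2))" for b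
  proof -
    have "(LINT y|lborel. f b y) = (CLINT y|std_normal_distribution. iexp ((- (t \<bullet> b)) * y))"
      by (subst integral_density) (auto simp: f_def normal_density_nonneg scaleR_conv_of_real mult_ac)
    also have "\<dots> = char std_normal_distribution (- (t \<bullet> b))" by (simp add: char_def)
    finally show ?thesis by (simp add: char_std_normal_distribution)
  qed
  have eq: "(\<Prod>b\<in>Basis. f b (x \<bullet> b)) = wave (x \<bullet> t) * gauss x" for x
  proof -
    have "(\<Prod>b\<in>Basis. wave (x \<bullet> b * (t \<bullet> b))) = wave (x \<bullet> t)"
      by (subst (2) euclidean_inner) (simp add: exp_sum[symmetric] sum_distrib_left sum_negf)
    then show ?thesis by (simp add: f_def prod.distrib gauss_eq_prod)
  qed
  have [measurable]: "f b \<in> borel_measurable borel" for b using f_int[of b] by simp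
  have coord: "(\<Sum>c\<in>Basis. y c *\<^sub>R c) \<bullet> b = y b" if "b \<in> Basis" for y :: "'a \<Rightarrow> real" and b
    using that by (simp add: inner_sum_left inner_Basis if_distrib sum.delta cong: if_cong)
  have "integrable (\<Pi>\<^sub>M b\<in>Basis. lborel) (\<lambda>y::'a \<Rightarrow> real. \<Prod>b\<in>Basis. f b (y b))"
    by (intro product_integrable_prod f_int) auto
  then have "integrable (lborel::'a measure) (\<lambda>x. \<Prod>b\<in>Basis. f b (x \<bullet> b))"
    by (subst lborel_eq, subst integrable_distr_eq) (auto simp: coord cong: prod.cong)
  then have "integrable lborel (\<lambda>x::'a. wave (x \<bullet> t) * gauss x)" by (simp add: eq)
  from integrable_norm[OF this] show "integrable lborel (\<lambda>x::'a. gauss x)"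
    by (simp add: norm_mult abs_of_pos[OF gauss_pos])
  have "(LINT x|(lborel::'a measure). (\<Prod>b\<in>Basis. f b (x \<bullet> b))) = (LINT y|(\<Pi>\<^sub>M b\<in>Basis. lborel). (\<Prod>b\<in>Basis. f b (y b)))"
    by (subst lborel_eq, subst integral_distr) (auto simp: coord cong: prod.cong)
  also have "\<dots> = (\<Prod>b\<in>Basis. LINT y|lborel. f b y)"
    by (intro product_integral_prod f_int) auto
  also have "\<dots> = of_real (exp (- (norm t)\<^sup>2 / 2))"
  proof -
    have "(norm t)\<^sup>2 = (\<Sum>b\<in>Basis. (t \<bullet> b)\<^sup>2)"
      by (subst power2_norm_eq_inner, subst euclidean_inner) (simp add: power2_eq_square)
    then show ?thesis
      by (simp add: f_val exp_sum[symmetric] sum_negf sum_divide_distrib flip: of_real_prod)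
  qed
  finally show "(LINT x|lborel. wave (x \<bullet> t) * gauss x) = of_real (exp (- (norm t)\<^sup>2 / 2))"
    by (simp add: eq)
qed

lemma gauss_integral: "(LINT x::'a::euclidean_space|lborel. gauss x) = 1"
  using gauss_fourier(2)[of "0::'a"] by (simp add: integral_complex_of_real)

text \<open>The convolution of \<open>u\<close> with its reflected conjugate. Its Fourier transform
  is the squared modulus of that of \<open>u\<close>, and its value at 0 is the squared norm of
  \<open>u\<close>, so Plancherel's identity is Fourier inversion for it at the origin.\<close>

definition autocorr :: "('a::euclidean_space \<Rightarrow> complex) \<Rightarrow> 'a \<Rightarrow> complex" where
  "autocorr u w = (LINT x|lborel. u x * cnj (u (x - w)))"

text \<open>The phase splits as \<open>w = x - (x - w)\<close>: after Fubini and the substitution of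
  \<open>x - w\<close> for \<open>w\<close>, the double integral is the product of the transform of
  \<open>u\<close> and its conjugate.\<close>

lemma autocorr_fourier:
  fixes u :: "'a::euclidean_space \<Rightarrow> complex"
  assumes u: "integrable lborel u"
  shows "integrable lborel (autocorr u)"
    and "(LINT w|lborel. wave (w \<bullet> \<xi>) * autocorr u w) = of_real ((cmod (LINT x|lborel. wave (x \<bullet> \<xi>) * u x))\<^sup>2)"
proof -
  have [measurable]: "u \<in> borel_measurable borel" using u by simp
  have refl: "integrable lborel (\<lambda>w. h (x - w))" "(LINT w|lborel. h (x - w)) = (LINT w|lborel. h w)"
    if "integrable lborel h" for h :: "'a \<Rightarrow> 'b::{banach, second_countable_topology}" and x
    using lborel_affine_integral[of "-1", OF _ that, of x] by auto
  define f where "f = (\<lambda>(x, w). u x * cnj (u (x - w)))"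
  have [measurable]: "f \<in> borel_measurable (lborel \<Otimes>\<^sub>M lborel)"
    unfolding f_def by measurable
  have un: "integrable lborel (\<lambda>x. cmod (u x))" "integrable lborel (\<lambda>x. cnj (u x))" using u by auto
  have f_int: "integrable (lborel \<Otimes>\<^sub>M lborel) f"
  proof (rule lborel_pair.Fubini_integrable)
    have "(LINT w|lborel. norm (f (x, w))) = cmod (u x) * (LINT w|lborel. cmod (u w))" for x
      using refl[OF un(1)] by (simp add: f_def norm_mult)
    then show "integrable lborel (\<lambda>x. LINT w|lborel. norm (f (x, w)))"
      using un by simp
    show "AE x in lborel. integrable lborel (\<lambda>w. f (x, w))"
      unfolding f_def using refl(1)[OF un(2)] by auto
  qed measurable
  have ac: "autocorr u = (\<lambda>w. LINT x|lborel. f (x, w))"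
    by (simp add: fun_eq_iff autocorr_def f_def)
  show "integrable lborel (autocorr u)"
    unfolding ac using lborel_pair.integrable_snd[of "\<lambda>x w. f (x, w)"] f_int by simp
  define g where "g = (\<lambda>x w. wave (w \<bullet> \<xi>) * f (x, w))"
  have gm[measurable]: "case_prod g \<in> borel_measurable (lborel \<Otimes>\<^sub>M lborel)"
    unfolding g_def by measurable
  have g_int: "integrable (lborel \<Otimes>\<^sub>M lborel) (case_prod g)"
    by (rule Bochner_Integration.integrable_bound[OF f_int]) (auto simp: g_def norm_mult)
  let ?U = "LINT x|lborel. wave (x \<bullet> \<xi>) * u x"
  have "(LINT w|lborel. wave (w \<bullet> \<xi>) * autocorr u w) = (LINT w|lborel. LINT x|lborel. g x w)"
    by (simp add: ac g_def)
  also have "\<dots> = (LINT x|lborel. LINT w|lborel. g x w)"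
    by (rule lborel_pair.Fubini_integral[OF g_int])
  also have "\<dots> = (LINT x|lborel. (wave (x \<bullet> \<xi>) * u x) * cnj ?U)"
  proof (rule Bochner_Integration.integral_cong)
    fix x
    have "g x w = wave (x \<bullet> \<xi>) * u x * cnj (wave ((x - w) \<bullet> \<xi>) * u (x - w))" for w
      by (simp add: g_def f_def exp_cnj inner_diff_left exp_diff exp_minus field_simps)
    then have "(LINT w|lborel. g x w) = wave (x \<bullet> \<xi>) * u x * (LINT w|lborel. cnj (wave ((x - w) \<bullet> \<xi>) * u (x - w)))"
      by simp
    also have "(LINT w|lborel. cnj (wave ((x - w) \<bullet> \<xi>) * u (x - w))) = (LINT w|lborel. cnj (wave (w \<bullet> \<xi>) * u w))"
      by (rule refl(2)[OF integrable_cnj[OF integrable_wave_mult[OF u]]]) measurable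
    also have "\<dots> = cnj ?U" by (rule Bochner_Integration.integral_cnj)
    finally show "(LINT w|lborel. g x w) = (wave (x \<bullet> \<xi>) * u x) * cnj ?U" .
  qed simp
  also have "\<dots> = ?U * cnj ?U" by (rule integral_mult_left_zero)
  finally show "(LINT w|lborel. wave (w \<bullet> \<xi>) * autocorr u w) = of_real ((cmod ?U)\<^sup>2)"
    by (simp only: complex_norm_square)
qed

lemma fourier_measurable [measurable]:
  assumes [measurable]: "u \<in> borel_measurable borel"
  shows "fourier u \<in> borel_measurable borel"
  unfolding fourier_def[abs_def] by measurable

lemma norm_fourier_sq:
  fixes u :: "'a::euclidean_space \<Rightarrow> complex"
  shows "(cmod (fourier u \<xi>))\<^sup>2 = (2 * pi) powr (- real DIM('a)) * (cmod (LINT x|lborel. wave (x \<bullet> \<xi>) * u x))\<^sup>2"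
proof -
  have "((2 * pi) powr (- real DIM('a) / 2))\<^sup>2 = (2 * pi) powr (- real DIM('a))"
    by (simp add: power2_eq_square powr_add[symmetric])
  then show ?thesis by (simp add: fourier_def norm_mult power_mult_distrib)
qed

lemma fourier_bound:
  assumes "integrable lborel u"
  shows "cmod (fourier u (\<xi>::'a::euclidean_space)) \<le> (2 * pi) powr (- real DIM('a) / 2) * (LINT x|lborel. cmod (u x))"
proof -
  have "cmod (LINT x|lborel. wave (x \<bullet> \<xi>) * u x) \<le> (LINT x|lborel. cmod (wave (x \<bullet> \<xi>) * u x))"
    by (rule integral_norm_bound)
  then show ?thesis by (simp add: fourier_def norm_mult)
qed

text \<open>The integral carries no normalising factor: one power
  \<open>(2 * pi) powr (n / 2)\<close> comes from the Fourier integral of the Gaussian, the other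
  from the normalisation inside \<open>gauss\<close>.\<close>

lemma gauss_fourier_scaled:
  fixes w :: "'a::euclidean_space"
  assumes "e > 0"
  shows "integrable lborel (\<lambda>\<xi>::'a. exp (- (norm (e *\<^sub>R \<xi>))\<^sup>2 / 2))"
    and "(LINT \<xi>|lborel. wave (w \<bullet> \<xi>) * of_real (exp (- (norm (e *\<^sub>R \<xi>))\<^sup>2 / 2))) =
      of_real ((2 * pi) powr real DIM('a) * gauss ((1 / e) *\<^sub>R w) / e ^ DIM('a))"
proof -
  let ?c = "(2 * pi) powr (- real DIM('a) / 2)"
  have c: "?c > 0" "(2 * pi) powr real DIM('a) * ?c * ?c = 1" by (auto simp: powr_add[symmetric])
  have E: "exp (- (norm (e *\<^sub>R \<xi>))\<^sup>2 / 2) = gauss (0 + e *\<^sub>R \<xi>) / ?c" for \<xi> :: 'a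
    by (simp add: gauss_def)
  show "integrable lborel (\<lambda>\<xi>::'a. exp (- (norm (e *\<^sub>R \<xi>))\<^sup>2 / 2))"
    unfolding E by (intro integrable_divide lborel_affine_integral(1) gauss_fourier) (use assms in simp)
  let ?h = "\<lambda>\<xi>::'a. wave (\<xi> \<bullet> ((1 / e) *\<^sub>R w)) * of_real (gauss \<xi>)"
  have h: "integrable lborel ?h"
    by (intro integrable_wave_mult integrable_of_real gauss_fourier) auto
  have "(LINT \<xi>|lborel. wave (w \<bullet> \<xi>) * of_real (exp (- (norm (e *\<^sub>R \<xi>))\<^sup>2 / 2))) =
      (LINT \<xi>|lborel. ?h (0 + e *\<^sub>R \<xi>) / of_real ?c)"
    using assms unfolding E by (intro Bochner_Integration.integral_cong) (auto simp: inner_commute)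
  also have "\<dots> = ((1 / e ^ DIM('a)) *\<^sub>R (LINT \<xi>|lborel. ?h \<xi>)) / of_real ?c"
    using lborel_affine_integral(2)[OF _ h, of e 0] assms by simp
  also have "\<dots> = of_real (1 / e ^ DIM('a) * exp (- (norm ((1 / e) *\<^sub>R w))\<^sup>2 / 2) / ?c)"
    unfolding gauss_fourier(2) by (simp add: scaleR_conv_of_real)
  also have "1 / e ^ DIM('a) * exp (- (norm ((1 / e) *\<^sub>R w))\<^sup>2 / 2) / ?c =
     (2 * pi) powr real DIM('a) * gauss ((1 / e) *\<^sub>R w) / e ^ DIM('a)"
    using c assms by (simp add: gauss_def field_simps)
  finally show "(LINT \<xi>|lborel. wave (w \<bullet> \<xi>) * of_real (exp (- (norm (e *\<^sub>R \<xi>))\<^sup>2 / 2))) =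
      of_real ((2 * pi) powr real DIM('a) * gauss ((1 / e) *\<^sub>R w) / e ^ DIM('a))" .
qed

text \<open>The Gaussian damping makes the double integral over \<open>\<xi>\<close> and
  \<open>w\<close> absolutely convergent while the integrability of the squared transform is still
  unknown. On the other side it becomes an average of \<open>autocorr u\<close> at scale
  \<open>e\<close>, which concentrates at the origin as \<open>e\<close> tends to 0.\<close>

lemma gauss_regularized_plancherel:
  fixes u :: "'a::euclidean_space \<Rightarrow> complex"
  assumes u: "integrable lborel u" and e: "e > 0"
  shows "integrable lborel (\<lambda>\<xi>::'a. (cmod (fourier u \<xi>))\<^sup>2 * exp (- (norm (e *\<^sub>R \<xi>))\<^sup>2 / 2))"
    and "of_real (LINT \<xi>|lborel. (cmod (fourier u \<xi>))\<^sup>2 * exp (- (norm (e *\<^sub>R \<xi>))\<^sup>2 / 2)) =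
      (LINT z|lborel. autocorr u (e *\<^sub>R z) * of_real (gauss z))"
proof -
  let ?E = "\<lambda>\<xi>::'a. exp (- (norm (e *\<^sub>R \<xi>))\<^sup>2 / 2)" and ?p = "(2 * pi) powr real DIM('a)"
  have [measurable]: "u \<in> borel_measurable borel" using u by simp
  have E: "integrable lborel ?E" using gauss_fourier_scaled[OF e] by simp
  have a: "integrable lborel (autocorr u)" using autocorr_fourier(1)[OF u] .
  then have [measurable]: "autocorr u \<in> borel_measurable borel" by simp
  define B where "B = ((2 * pi) powr (- real DIM('a) / 2) * (LINT x|lborel. cmod (u x)))\<^sup>2"
  have "(cmod (fourier u \<xi>))\<^sup>2 \<le> B" for \<xi>
    unfolding B_def by (intro power_mono fourier_bound u) auto
  then show "integrable lborel (\<lambda>\<xi>::'a. (cmod (fourier u \<xi>))\<^sup>2 * ?E \<xi>)"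
    by (intro Bochner_Integration.integrable_bound[OF integrable_mult_right[OF E, of B]])
       (auto simp: abs_mult intro!: mult_right_mono order_trans[OF _ abs_ge_self])
  define g where "g = (\<lambda>\<xi> w. of_real (?E \<xi>) * (wave (w \<bullet> \<xi>) * autocorr u w))"
  have [measurable]: "case_prod g \<in> borel_measurable (lborel \<Otimes>\<^sub>M lborel)"
    unfolding g_def by measurable
  have g: "integrable (lborel \<Otimes>\<^sub>M lborel) (case_prod g)"
  proof (rule lborel_pair.Fubini_integrable)
    show "integrable lborel (\<lambda>\<xi>. LINT w|lborel. norm (case_prod g (\<xi>, w)))"
      using E by (simp add: g_def norm_mult)
    show "AE \<xi> in lborel. integrable lborel (\<lambda>w. case_prod g (\<xi>, w))"
      unfolding g_def split_conv using a by (intro AE_I2 integrable_mult_right integrable_wave_mult) auto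
  qed measurable
  have "of_real (LINT \<xi>|lborel. (cmod (fourier u \<xi>))\<^sup>2 * ?E \<xi>) =
     (LINT \<xi>|lborel. of_real ((cmod (fourier u \<xi>))\<^sup>2 * ?E \<xi>) :: complex)"
    by (rule integral_complex_of_real[symmetric])
  also have "\<dots> = of_real (1 / ?p) * (LINT \<xi>|lborel. LINT w|lborel. g \<xi> w)"
  proof -
    have "of_real ((cmod (fourier u \<xi>))\<^sup>2 * ?E \<xi>) = of_real (1 / ?p) * (LINT w|lborel. g \<xi> w)" for \<xi>
      unfolding g_def integral_mult_right_zero autocorr_fourier(2)[OF u] norm_fourier_sq
      by (simp add: powr_minus_divide)
    then show ?thesis by simp
  qed
  also have "(LINT \<xi>|lborel. LINT w|lborel. g \<xi> w) = (LINT w|lborel. LINT \<xi>|lborel. g \<xi> w)"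
    by (rule lborel_pair.Fubini_integral[OF g, symmetric])
  also have "\<dots> = (LINT w|lborel. autocorr u w * of_real (?p * gauss ((1 / e) *\<^sub>R w) / e ^ DIM('a)))"
  proof (rule Bochner_Integration.integral_cong)
    fix w
    have "(LINT \<xi>|lborel. g \<xi> w) = (LINT \<xi>|lborel. autocorr u w * (wave (w \<bullet> \<xi>) * of_real (?E \<xi>)))"
      by (simp add: g_def mult_ac)
    then show "(LINT \<xi>|lborel. g \<xi> w) = autocorr u w * of_real (?p * gauss ((1 / e) *\<^sub>R w) / e ^ DIM('a))"
      by (simp only: integral_mult_right_zero gauss_fourier_scaled(2)[OF e])
  qed simp
  also have "of_real (1 / ?p) * \<dots> = of_real (1 / e ^ DIM('a)) * (LINT w|lborel. autocorr u w * of_real (gauss ((1 / e) *\<^sub>R w)))"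
  proof -
    let ?G = "\<lambda>w. of_real (gauss ((1 / e) *\<^sub>R w)) :: complex"
    have "autocorr u w * of_real (?p * gauss ((1 / e) *\<^sub>R w) / e ^ DIM('a)) = of_real (?p / e ^ DIM('a)) * (autocorr u w * ?G w)" for w
      by simp
    then have "(LINT w|lborel. autocorr u w * of_real (?p * gauss ((1 / e) *\<^sub>R w) / e ^ DIM('a))) =
      of_real (?p / e ^ DIM('a)) * (LINT w|lborel. autocorr u w * ?G w)"
      by (simp only: integral_mult_right_zero)
    moreover have "of_real (1 / ?p) * (of_real (?p / e ^ DIM('a)) * c) = of_real (1 / e ^ DIM('a)) * c" for c :: complex
      by simp
    ultimately show ?thesis by (simp only:)
  qed
  also have "\<dots> = (LINT z|lborel. autocorr u (e *\<^sub>R z) * of_real (gauss z))"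
  proof -
    let ?h = "\<lambda>w. autocorr u w * of_real (gauss ((1 / e) *\<^sub>R w))"
    have "integrable lborel ?h"
    proof (rule Bochner_Integration.integrable_bound[OF integrable_mult_left[OF a, of "of_real ((2 * pi) powr (- real DIM('a) / 2))"]])
      show "AE w in lborel. norm (?h w) \<le> norm (autocorr u w * of_real ((2 * pi) powr (- real DIM('a) / 2)))"
        by (auto simp: norm_mult gauss_def intro!: mult_left_mono)
    qed measurable
    from lborel_affine_integral(2)[OF _ this, of e 0] e show ?thesis
      by (simp add: scaleR_conv_of_real)
  qed
  finally show "of_real (LINT \<xi>|lborel. (cmod (fourier u \<xi>))\<^sup>2 * ?E \<xi>) =
      (LINT z|lborel. autocorr u (e *\<^sub>R z) * of_real (gauss z))" .
qed

section \<open>The two halves of Plancherel's identity\<close>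

definition L1_L2 :: "('a::euclidean_space \<Rightarrow> complex) set" where
  "L1_L2 = {u. integrable lborel u \<and> integrable lborel (\<lambda>x. (cmod (u x))\<^sup>2)}"

abbreviation sqnorm :: "('a::euclidean_space \<Rightarrow> complex) \<Rightarrow> real" where
  "sqnorm u \<equiv> (LINT x|lborel. (cmod (u x))\<^sup>2)"

lemma L1_L2_D [dest]:
  assumes "u \<in> L1_L2"
  shows "integrable lborel u" "integrable lborel (\<lambda>x. (cmod (u x))\<^sup>2)" "u \<in> borel_measurable borel"
  using assms by (auto simp: L1_L2_def)

text \<open>The coefficient of the main term can be brought arbitrarily close to 1 at the expense of
  the error term, so squared norms can be compared in limits by letting \<open>s\<close> tend to 0.
  The defect is the square \<open>(s * cmod a - cmod b)^2 / s\<close>.\<close>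

lemma cmod_add_sq_le:
  fixes a b :: complex
  assumes "s > 0"
  shows "(cmod (a + b))\<^sup>2 \<le> (1 + s) * (cmod a)\<^sup>2 + (1 + 1 / s) * (cmod b)\<^sup>2"
proof -
  have "(cmod (a + b))\<^sup>2 \<le> (cmod a + cmod b)\<^sup>2" by (intro power_mono norm_triangle_ineq) auto
  also have "\<dots> = (1 + s) * (cmod a)\<^sup>2 + (1 + 1 / s) * (cmod b)\<^sup>2 - (s * cmod a - cmod b)\<^sup>2 / s"
    using assms by (simp add: field_simps power2_eq_square)
  also have "\<dots> \<le> (1 + s) * (cmod a)\<^sup>2 + (1 + 1 / s) * (cmod b)\<^sup>2" using assms by simp
  finally show ?thesis .
qed

lemma L1_L2_diff:
  assumes "u \<in> L1_L2" "v \<in> L1_L2"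
  shows "(\<lambda>x. u x - v x) \<in> L1_L2"
proof -
  have "integrable lborel (\<lambda>x. (cmod (u x - v x))\<^sup>2)"
  proof (rule Bochner_Integration.integrable_bound)
    show "integrable lborel (\<lambda>x. 2 * (cmod (u x))\<^sup>2 + 2 * (cmod (v x))\<^sup>2)"
      using assms[THEN L1_L2_D(2)] by simp
    show "AE x in lborel. norm ((cmod (u x - v x))\<^sup>2) \<le> norm (2 * (cmod (u x))\<^sup>2 + 2 * (cmod (v x))\<^sup>2)"
      using cmod_add_sq_le[of 1 "u x" "- v x" for x] by auto
  qed (use assms in \<open>auto dest!: L1_L2_D(3)\<close>)
  then show ?thesis using assms by (auto simp: L1_L2_def)
qed

text \<open>The elementary bound of a product by half the sum of squares suffices, since the
  translated factor has the same norm.\<close>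

lemma autocorr_bound:
  assumes "u \<in> L1_L2"
  shows "cmod (autocorr u w) \<le> sqnorm u"
proof -
  have i: "integrable lborel (\<lambda>x. (cmod (u (x - w)))\<^sup>2)" "(LINT x|lborel. (cmod (u (x - w)))\<^sup>2) = sqnorm u"
    using lborel_affine_integral[of 1, OF _ L1_L2_D(2)[OF assms], of "- w"] by auto
  have "cmod (autocorr u w) \<le> (LINT x|lborel. cmod (u x * cnj (u (x - w))))"
    unfolding autocorr_def by (rule integral_norm_bound)
  also have "\<dots> \<le> (LINT x|lborel. ((cmod (u x))\<^sup>2 + (cmod (u (x - w)))\<^sup>2) / 2)"
  proof (rule integral_mono')
    show "integrable lborel (\<lambda>x. ((cmod (u x))\<^sup>2 + (cmod (u (x - w)))\<^sup>2) / 2)"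
      using i assms by auto
    show "cmod (u x * cnj (u (x - w))) \<le> ((cmod (u x))\<^sup>2 + (cmod (u (x - w)))\<^sup>2) / 2" for x
      using sum_squares_bound[of "cmod (u x)" "cmod (u (x - w))"] by (simp add: norm_mult)
  qed auto
  also have "\<dots> = sqnorm u" using i L1_L2_D(2)[OF assms] by simp
  finally show ?thesis .
qed

lemma gauss_damping_tendsto:
  fixes \<xi> :: "'a::euclidean_space"
  shows "(\<lambda>m. exp (- (norm ((1 / Suc m) *\<^sub>R \<xi>))\<^sup>2 / 2)) \<longlonglongrightarrow> 1"
proof -
  have "(\<lambda>m. exp (- (norm ((1 / Suc m) *\<^sub>R \<xi>))\<^sup>2 / 2)) \<longlonglongrightarrow> exp (- (norm (0 *\<^sub>R \<xi>))\<^sup>2 / 2)"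
    by (intro tendsto_intros LIMSEQ_Suc lim_1_over_n) auto
  then show ?thesis by simp
qed

text \<open>The damped integrals are averages of \<open>autocorr u\<close> against a Gaussian of
  mass 1, hence at most \<open>sqnorm u\<close>. Fatou's lemma removes the damping.\<close>

lemma fourier_sqnorm_le:
  fixes u :: "'a::euclidean_space \<Rightarrow> complex"
  assumes u: "u \<in> L1_L2"
  shows "integrable lborel (\<lambda>\<xi>. (cmod (fourier u \<xi>))\<^sup>2)" and "sqnorm (fourier u) \<le> sqnorm u"
proof -
  define E where "E = (\<lambda>m (\<xi>::'a). exp (- (norm ((1 / Suc m) *\<^sub>R \<xi>))\<^sup>2 / 2))"
  have [measurable]: "u \<in> borel_measurable borel" using u by auto
  have [measurable]: "E m \<in> borel_measurable borel" for m unfolding E_def by measurable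
  have le: "(LINT \<xi>|lborel. (cmod (fourier u \<xi>))\<^sup>2 * E m \<xi>) \<le> sqnorm u" for m
  proof -
    let ?I = "LINT \<xi>|lborel. (cmod (fourier u \<xi>))\<^sup>2 * E m \<xi>"
    have "cmod (of_real ?I) \<le> (LINT z::'a|lborel. cmod (autocorr u ((1 / Suc m) *\<^sub>R z) * of_real (gauss z)))"
      unfolding E_def by (subst gauss_regularized_plancherel(2)) (use u in \<open>auto intro: integral_norm_bound\<close>)
    also have "\<dots> \<le> (LINT z::'a|lborel. sqnorm u * gauss z)"
    proof (rule integral_mono')
      show "cmod (autocorr u ((1 / Suc m) *\<^sub>R z) * of_real (gauss z)) \<le> sqnorm u * gauss z" for z
        using autocorr_bound[OF u, of "(1 / Suc m) *\<^sub>R z"] gauss_pos[of z]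
        by (simp add: norm_mult mult_right_mono)
    qed (use gauss_fourier(1) gauss_pos in \<open>auto intro!: mult_nonneg_nonneg intro: less_imp_le\<close>)
    also have "\<dots> = sqnorm u" by (simp add: gauss_integral)
    finally show ?thesis by simp
  qed
  have nn: "(\<integral>\<^sup>+\<xi>. ennreal ((cmod (fourier u \<xi>))\<^sup>2 * E m \<xi>) \<partial>lborel) \<le> ennreal (sqnorm u)" for m
    using gauss_regularized_plancherel(1)[OF L1_L2_D(1)[OF u], of "1 / Suc m"] le[of m]
    by (subst nn_integral_eq_integral) (auto simp: E_def intro!: ennreal_leI)
  have "(\<integral>\<^sup>+\<xi>. ennreal ((cmod (fourier u \<xi>))\<^sup>2) \<partial>lborel) =
      (\<integral>\<^sup>+\<xi>. liminf (\<lambda>m. ennreal ((cmod (fourier u \<xi>))\<^sup>2 * E m \<xi>)) \<partial>lborel)"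
  proof (rule nn_integral_cong)
    fix \<xi>
    have "(\<lambda>m. ennreal ((cmod (fourier u \<xi>))\<^sup>2 * E m \<xi>)) \<longlonglongrightarrow> ennreal ((cmod (fourier u \<xi>))\<^sup>2 * 1)"
      unfolding E_def by (intro tendsto_ennrealI tendsto_mult tendsto_const gauss_damping_tendsto)
    then show "ennreal ((cmod (fourier u \<xi>))\<^sup>2) = liminf (\<lambda>m. ennreal ((cmod (fourier u \<xi>))\<^sup>2 * E m \<xi>))"
      by (simp add: lim_imp_Liminf)
  qed
  also have "\<dots> \<le> liminf (\<lambda>m. \<integral>\<^sup>+\<xi>. ennreal ((cmod (fourier u \<xi>))\<^sup>2 * E m \<xi>) \<partial>lborel)"
    by (rule nn_integral_liminf) measurable
  also have "\<dots> \<le> ennreal (sqnorm u)"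
    using nn by (intro Liminf_le) auto
  finally have *: "(\<integral>\<^sup>+\<xi>. ennreal ((cmod (fourier u \<xi>))\<^sup>2) \<partial>lborel) \<le> ennreal (sqnorm u)" .
  then show "integrable lborel (\<lambda>\<xi>. (cmod (fourier u \<xi>))\<^sup>2)"
    by (intro integrableI_nonneg) (auto intro: le_less_trans)
  show "sqnorm (fourier u) \<le> sqnorm u"
    using enn2real_mono[OF *] by (subst integral_eq_nn_integral) (auto)
qed

text \<open>By continuity and domination by \<open>B * cmod (u x)\<close> the autocorrelation tends
  to \<open>sqnorm u\<close> at the origin, and so do its Gaussian averages. The damped integrals
  therefore tend to \<open>sqnorm u\<close>, and each of them is at most the undamped one.\<close>

lemma fourier_sqnorm_ge_continuous:
  fixes u :: "'a::euclidean_space \<Rightarrow> complex"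
  assumes u: "u \<in> L1_L2" and cont: "continuous_on UNIV u" and B: "\<And>x. cmod (u x) \<le> B"
  shows "sqnorm u \<le> sqnorm (fourier u)"
proof -
  have [measurable]: "u \<in> borel_measurable borel" using u by auto
  have [measurable]: "autocorr u \<in> borel_measurable borel"
    using autocorr_fourier(1)[OF L1_L2_D(1)[OF u]] by simp
  have A: "(\<lambda>m. autocorr u ((1 / Suc m) *\<^sub>R z)) \<longlonglongrightarrow> of_real (sqnorm u)" for z :: 'a
  proof -
    have "(\<lambda>m. LINT x|lborel. u x * cnj (u (x - (1 / Suc m) *\<^sub>R z))) \<longlonglongrightarrow> (LINT x|lborel. u x * cnj (u (x - 0 *\<^sub>R z)))"
    proof (rule integral_dominated_convergence[where w = "\<lambda>x. B * cmod (u x)"])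
      show "AE x in lborel. (\<lambda>m. u x * cnj (u (x - (1 / Suc m) *\<^sub>R z))) \<longlonglongrightarrow> u x * cnj (u (x - 0 *\<^sub>R z))"
      proof (intro AE_I2 tendsto_intros)
        fix x
        have "(\<lambda>m. x - (1 / Suc m) *\<^sub>R z) \<longlonglongrightarrow> x - 0 *\<^sub>R z"
          by (intro tendsto_intros LIMSEQ_Suc lim_1_over_n)
        then show "(\<lambda>m. u (x - (1 / Suc m) *\<^sub>R z)) \<longlonglongrightarrow> u (x - 0 *\<^sub>R z)"
          using cont by (auto intro: continuous_on_tendsto_compose)
      qed
      show "AE x in lborel. norm (u x * cnj (u (x - (1 / Suc m) *\<^sub>R z))) \<le> B * cmod (u x)" for m
        using B by (auto simp: norm_mult mult.commute[of B] intro!: mult_left_mono)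
      show "integrable lborel (\<lambda>x. B * cmod (u x))" using u by auto
    qed measurable
    moreover have "(LINT x|lborel. u x * cnj (u (x - 0 *\<^sub>R z))) = of_real (sqnorm u)"
      by (simp only: scaleR_zero_left diff_zero complex_norm_square[symmetric] integral_complex_of_real)
    ultimately show ?thesis by (simp add: autocorr_def)
  qed
  have "(\<lambda>m. LINT z::'a|lborel. autocorr u ((1 / Suc m) *\<^sub>R z) * of_real (gauss z)) \<longlonglongrightarrow>
     (LINT z::'a|lborel. of_real (sqnorm u) * of_real (gauss z))"
  proof (rule integral_dominated_convergence[where w = "\<lambda>z. sqnorm u * gauss z"])
    show "AE z in lborel. (\<lambda>m. autocorr u ((1 / Suc m) *\<^sub>R z) * of_real (gauss z)) \<longlonglongrightarrow> of_real (sqnorm u) * of_real (gauss (z::'a))"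
      by (intro AE_I2 tendsto_mult A tendsto_const)
    show "AE z in lborel. norm (autocorr u ((1 / Suc m) *\<^sub>R z) * of_real (gauss z)) \<le> sqnorm u * gauss z" for m
      using autocorr_bound[OF u] gauss_pos[where 'a='a]
      by (auto simp: norm_mult less_imp_le abs_of_pos intro!: mult_right_mono)
    show "integrable lborel (\<lambda>z::'a. sqnorm u * gauss z)" using gauss_fourier(1) by auto
  qed measurable
  also have "(LINT z::'a|lborel. of_real (sqnorm u) * of_real (gauss z)) = complex_of_real (sqnorm u)"
    by (simp add: integral_complex_of_real gauss_integral)
  also have "(\<lambda>m. LINT z::'a|lborel. autocorr u ((1 / Suc m) *\<^sub>R z) * of_real (gauss z)) =
     (\<lambda>m. of_real (LINT \<xi>|lborel. (cmod (fourier u \<xi>))\<^sup>2 * exp (- (norm ((1 / Suc m) *\<^sub>R \<xi>))\<^sup>2 / 2)))"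
    by (intro ext gauss_regularized_plancherel(2)[symmetric]) (use u in auto)
  finally have lim: "(\<lambda>m. LINT \<xi>|lborel. (cmod (fourier u \<xi>))\<^sup>2 * exp (- (norm ((1 / Suc m) *\<^sub>R \<xi>))\<^sup>2 / 2)) \<longlonglongrightarrow> sqnorm u"
    by (simp only: tendsto_of_real_iff)
  show ?thesis
  proof (rule LIMSEQ_le_const2[OF lim], intro exI allI impI)
    fix m
    show "(LINT \<xi>|lborel. (cmod (fourier u \<xi>))\<^sup>2 * exp (- (norm ((1 / Suc m) *\<^sub>R \<xi>))\<^sup>2 / 2)) \<le> sqnorm (fourier u)"
      by (intro integral_mono' fourier_sqnorm_le[OF u]) (auto intro!: mult_left_le)
  qed
qed

lemma fourier_diff:
  assumes "integrable lborel u" "integrable lborel v"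
  shows "fourier (\<lambda>x. u x - v x) \<xi> = fourier u \<xi> - fourier v \<xi>"
proof -
  have "integrable lborel (\<lambda>x. wave (x \<bullet> \<xi>) * u x)" "integrable lborel (\<lambda>x. wave (x \<bullet> \<xi>) * v x)"
    by (intro integrable_wave_mult assms; measurable)+
  then show ?thesis by (simp add: fourier_def right_diff_distrib)
qed

text \<open>The inequality survives limits in the mean. One error arises from replacing
  \<open>u\<close> by \<open>v m\<close>, another from returning to \<open>u\<close> on the Fourier
  side, where the half already proved controls it. \<open>K\<close> collects both, and the main term
  carries \<open>(1 + s)\<close> twice.\<close>

lemma fourier_sqnorm_ge_limit:
  fixes u :: "'a::euclidean_space \<Rightarrow> complex"
  assumes u: "u \<in> L1_L2" and v: "\<And>m. v m \<in> L1_L2" and le: "\<And>m. sqnorm (v m) \<le> sqnorm (fourier (v m))"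
    and lim: "(\<lambda>m. sqnorm (\<lambda>x. u x - v m x)) \<longlonglongrightarrow> 0"
  shows "sqnorm u \<le> sqnorm (fourier u)"
proof -
  have main: "sqnorm u \<le> (1 + s) * (1 + s) * sqnorm (fourier u)" if s: "s > 0" for s
  proof -
    define K where "K = (1 + 1 / s) + (1 + s) * (1 + 1 / s)"
    have "sqnorm u \<le> (1 + s) * (1 + s) * sqnorm (fourier u) + K * sqnorm (\<lambda>x. u x - v m x)" for m
    proof -
      note uv = L1_L2_diff[OF u v, of m]
      let ?d = "\<lambda>x. u x - v m x"
      have "sqnorm u \<le> (LINT x|lborel. (1 + s) * (cmod (v m x))\<^sup>2 + (1 + 1 / s) * (cmod (?d x))\<^sup>2)"
      proof (rule integral_mono)
        show "(cmod (u x))\<^sup>2 \<le> (1 + s) * (cmod (v m x))\<^sup>2 + (1 + 1 / s) * (cmod (?d x))\<^sup>2" for x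
          using cmod_add_sq_le[OF s, of "v m x" "?d x"] by simp
      qed (use L1_L2_D(2)[OF u] L1_L2_D(2)[OF v[of m]] L1_L2_D(2)[OF uv] in simp_all)
      also have "\<dots> = (1 + s) * sqnorm (v m) + (1 + 1 / s) * sqnorm ?d"
        using L1_L2_D(2)[OF v[of m]] L1_L2_D(2)[OF uv] by simp
      finally have 1: "sqnorm u \<le> (1 + s) * sqnorm (v m) + (1 + 1 / s) * sqnorm ?d" .
      note le[of m]
      also have "sqnorm (fourier (v m)) \<le> (LINT \<xi>|lborel. (1 + s) * (cmod (fourier u \<xi>))\<^sup>2 + (1 + 1 / s) * (cmod (fourier ?d \<xi>))\<^sup>2)"
      proof (rule integral_mono)
        show "(cmod (fourier (v m) \<xi>))\<^sup>2 \<le> (1 + s) * (cmod (fourier u \<xi>))\<^sup>2 + (1 + 1 / s) * (cmod (fourier ?d \<xi>))\<^sup>2" for \<xi>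
          using cmod_add_sq_le[OF s, of "fourier u \<xi>" "- fourier ?d \<xi>"]
          by (simp add: fourier_diff[OF L1_L2_D(1)[OF u] L1_L2_D(1)[OF v]] norm_minus_commute)
      qed (use fourier_sqnorm_le(1)[OF u] fourier_sqnorm_le(1)[OF v] fourier_sqnorm_le(1)[OF uv] in auto)
      also have "\<dots> = (1 + s) * sqnorm (fourier u) + (1 + 1 / s) * sqnorm (fourier ?d)"
        using fourier_sqnorm_le(1)[OF u] fourier_sqnorm_le(1)[OF uv] by simp
      also have "\<dots> \<le> (1 + s) * sqnorm (fourier u) + (1 + 1 / s) * sqnorm ?d"
        using fourier_sqnorm_le(2)[OF uv] s by (intro add_left_mono mult_left_mono) auto
      finally have "sqnorm (v m) \<le> (1 + s) * sqnorm (fourier u) + (1 + 1 / s) * sqnorm ?d" .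
      then have "(1 + s) * sqnorm (v m) \<le> (1 + s) * ((1 + s) * sqnorm (fourier u) + (1 + 1 / s) * sqnorm ?d)"
        using s by (intro mult_left_mono) auto
      with 1 show ?thesis by (simp only: K_def distrib_left distrib_right mult.assoc)
    qed
    moreover have "(\<lambda>m. (1 + s) * (1 + s) * sqnorm (fourier u) + K * sqnorm (\<lambda>x. u x - v m x))
        \<longlonglongrightarrow> (1 + s) * (1 + s) * sqnorm (fourier u) + K * 0"
      by (rule tendsto_add[OF tendsto_const tendsto_mult[OF tendsto_const lim]])
    ultimately show ?thesis by (intro LIMSEQ_le_const[where X = "\<lambda>m. (1 + s) * (1 + s) * sqnorm (fourier u) + K * sqnorm (\<lambda>x. u x - v m x)"]) auto
  qed
  have "((\<lambda>s. (1 + s) * (1 + s) * sqnorm (fourier u)) \<longlongrightarrow> (1 + 0) * (1 + 0) * sqnorm (fourier u)) (at_right 0)"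
    by (rule tendsto_eq_intros refl)+
  then have "sqnorm u \<le> (1 + 0) * (1 + 0) * sqnorm (fourier u)"
    by (rule tendsto_lowerbound) (auto simp: main eventually_at_filter)
  then show ?thesis by simp
qed

section \<open>Approximation and Plancherel's identity for functions on a bounded set\<close>

lemma L2_imp_L1_L2:
  fixes D :: "'a::euclidean_space set"
  assumes "bounded D" "u \<in> L2 D"
  shows "u \<in> L1_L2"
proof -
  obtain r where r: "D \<subseteq> cball 0 r" using bounded_subset_ballD[OF assms(1), of 0] ball_subset_cball by fastforce
  have [measurable]: "u \<in> borel_measurable borel" using assms by (simp add: L2_def)
  have "integrable lborel u"
  proof (rule Bochner_Integration.integrable_bound)
    show "integrable lborel (\<lambda>x. indicator (cball (0::'a) r) x + (cmod (u x))\<^sup>2)"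
      using assms emeasure_lborel_cball_finite[of "0::'a" r]
      by (intro Bochner_Integration.integrable_add) (auto simp: L2_def integrable_indicator_iff)
    show "AE x in lborel. norm (u x) \<le> norm (indicator (cball (0::'a) r) x + (cmod (u x))\<^sup>2)"
    proof (rule AE_I2)
      fix x
      have "2 * cmod (u x) \<le> 1 + (cmod (u x))\<^sup>2"
        using sum_squares_bound[of 1 "cmod (u x)"] by simp
      then have "cmod (u x) \<le> 1 + (cmod (u x))\<^sup>2"
        using norm_ge_zero[of "u x"] by linarith
      moreover have "x \<notin> cball 0 r \<Longrightarrow> u x = 0" using r assms by (auto simp: L2_def)
      ultimately show "norm (u x) \<le> norm (indicator (cball (0::'a) r) x + (cmod (u x))\<^sup>2)"
        by (cases "x \<in> cball 0 r") auto
    qed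
  qed measurable
  then show ?thesis using assms by (auto simp: L1_L2_def L2_def)
qed

text \<open>Measurability already supplies continuous functions converging almost everywhere.
  Projecting their values onto the disc of radius \<open>B\<close> and multiplying by a radial
  cut-off restores the bounds; neither changes the limit, because the projection fixes the values of
  \<open>u\<close> and the cut-off is 1 where \<open>u\<close> may be nonzero.\<close>

lemma bounded_support_approx:
  fixes u :: "'a::euclidean_space \<Rightarrow> complex"
  assumes [measurable]: "u \<in> borel_measurable borel" and B: "\<And>x. cmod (u x) \<le> B"
    and supp: "\<And>x. norm x > r \<Longrightarrow> u x = 0"
  obtains v where "\<And>m. continuous_on UNIV (v m)" "\<And>m x. cmod (v m x) \<le> B"
    "\<And>m x. norm x > r + 1 \<Longrightarrow> v m x = 0" "AE x in lborel. (\<lambda>m. v m x) \<longlonglongrightarrow> u x"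
proof -
  have B0: "B \<ge> 0" using B[of 0] norm_ge_zero order_trans by blast
  have "u \<in> borel_measurable lebesgue"
    by (rule measurable_completion) simp
  then have "u measurable_on UNIV" by (simp add: measurable_on_iff_borel_measurable)
  then obtain N g where N: "negligible N" and g: "\<And>n. continuous_on UNIV (g n)"
    and lim: "\<And>x. x \<notin> N \<Longrightarrow> (\<lambda>n. g n x) \<longlonglongrightarrow> u x"
    unfolding measurable_on_def by auto
  define c where "c = closest_point (cball (0::complex) B)"
  define k where "k = (\<lambda>x::'a. max 0 (min 1 (r + 1 - norm x)))"
  define v where "v = (\<lambda>m x. k x *\<^sub>R c (g m x))"
  have c: "continuous_on UNIV c" "\<And>z. cmod (c z) \<le> B" "\<And>z. cmod z \<le> B \<Longrightarrow> c z = z"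
    using B0 closest_point_in_set[of "cball (0::complex) B"]
    by (auto simp: c_def intro!: continuous_on_closest_point closest_point_self)
  have k: "0 \<le> k x" "k x \<le> 1" for x by (auto simp: k_def)
  show ?thesis
  proof
    show "continuous_on UNIV (v m)" for m
      unfolding v_def k_def
      by (intro continuous_intros continuous_on_compose2[OF c(1) g]) auto
    show "cmod (v m x) \<le> B" for m x
      using mult_mono[OF k(2)[of x] c(2)[of "g m x"]] k(1)[of x] B0 by (simp add: v_def)
    show "norm x > r + 1 \<Longrightarrow> v m x = 0" for m x by (simp add: v_def k_def)
    have "AE x in lebesgue. x \<notin> N"
      using N by (simp add: negligible_iff_null_sets AE_not_in)
    then have "AE x in lebesgue. (\<lambda>m. v m x) \<longlonglongrightarrow> u x"
    proof eventually_elim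
      case (elim x)
      have "(\<lambda>m. c (g m x)) \<longlonglongrightarrow> c (u x)"
        by (rule continuous_on_tendsto_compose[OF c(1) lim]) (use elim in auto)
      then have "(\<lambda>m. v m x) \<longlonglongrightarrow> k x *\<^sub>R u x"
        unfolding v_def using c(3)[OF B] by (auto intro!: tendsto_intros)
      moreover have "k x *\<^sub>R u x = u x"
        using supp[of x] by (cases "norm x > r") (auto simp: k_def)
      ultimately show ?case by simp
    qed
    then show "AE x in lborel. (\<lambda>m. v m x) \<longlonglongrightarrow> u x"
      by (simp add: AE_completion_iff)
  qed
qed

text \<open>The lower bound passes through two nested limits: \<open>u\<close> is approximated by
  its truncations to values of size at most \<open>m\<close>, dominated by \<open>u\<close> itself,
  and each truncation by continuous functions dominated by a constant on a ball.\<close>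

theorem plancherel_L2:
  fixes D :: "'a::euclidean_space set"
  assumes D: "bounded D" and u: "u \<in> L2 D"
  shows "sqnorm (fourier u) = sqnorm u"
proof (rule antisym[OF fourier_sqnorm_le(2)[OF L2_imp_L1_L2[OF D u]]])
  obtain r where r: "D \<subseteq> cball 0 r" using bounded_subset_ballD[OF D, of 0] ball_subset_cball by fastforce
  have um[measurable]: "u \<in> borel_measurable borel" using u by (simp add: L2_def)
  note u12 = L2_imp_L1_L2[OF D u]
  have supp: "norm x > r \<Longrightarrow> u x = 0" for x using r u by (force simp: L2_def)
  define w where "w = (\<lambda>(m::nat) x. if cmod (u x) \<le> m then u x else 0)"
  have wm[measurable]: "w m \<in> borel_measurable borel" for m unfolding w_def by measurable
  have w12: "w m \<in> L1_L2" for m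
  proof -
    have "integrable lborel (w m)"
      by (rule Bochner_Integration.integrable_bound[OF L1_L2_D(1)[OF u12]]) (auto simp: w_def)
    moreover have "integrable lborel (\<lambda>x. (cmod (w m x))\<^sup>2)"
      by (rule Bochner_Integration.integrable_bound[OF L1_L2_D(2)[OF u12]]) (auto simp: w_def)
    ultimately show ?thesis by (simp add: L1_L2_def)
  qed
  show "sqnorm u \<le> sqnorm (fourier u)"
  proof (rule fourier_sqnorm_ge_limit[OF u12 w12])
    have "(\<lambda>m. sqnorm (\<lambda>x. u x - w m x)) \<longlonglongrightarrow> (LINT x::'a|lborel. 0)"
    proof (rule integral_dominated_convergence[where w = "\<lambda>x. (cmod (u x))\<^sup>2"])
      show "AE x in lborel. (\<lambda>m. (cmod (u x - w m x))\<^sup>2) \<longlonglongrightarrow> 0"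
      proof (rule AE_I2)
        fix x
        obtain m0 :: nat where "cmod (u x) \<le> m0" using real_arch_simple by blast
        then have "\<forall>\<^sub>F m in sequentially. (cmod (u x - w m x))\<^sup>2 = 0"
          by (intro eventually_sequentiallyI[of m0]) (auto simp: w_def)
        then show "(\<lambda>m. (cmod (u x - w m x))\<^sup>2) \<longlonglongrightarrow> 0" by (rule tendsto_eventually)
      qed
      show "AE x in lborel. norm ((cmod (u x - w m x))\<^sup>2) \<le> (cmod (u x))\<^sup>2" for m
        by (auto simp: w_def)
    qed (use u12 in auto)
    then show "(\<lambda>m. sqnorm (\<lambda>x. u x - w m x)) \<longlonglongrightarrow> 0" by simp
    fix m
    have wB: "cmod (w m x) \<le> m" for x by (simp add: w_def)
    have wr: "norm x > r \<Longrightarrow> w m x = 0" for x using supp by (simp add: w_def)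
    obtain v where v: "\<And>j. continuous_on UNIV (v j)" "\<And>j x. cmod (v j x) \<le> m"
      "\<And>j x. norm x > r + 1 \<Longrightarrow> v j x = 0" "AE x in lborel. (\<lambda>j. v j x) \<longlonglongrightarrow> w m x"
      by (rule bounded_support_approx[where r = r, OF wm wB wr]) (assumption, rule that)
    have [measurable]: "v j \<in> borel_measurable borel" for j
      using v(1) by (rule borel_measurable_continuous_onI)
    let ?b = "cball (0::'a) (r + 1)"
    have ib: "integrable lborel (\<lambda>x. c * indicator ?b x)" for c :: real
      using emeasure_lborel_cball_finite[of "0::'a" "r + 1"]
      by (intro integrable_mult_right) (simp add: integrable_indicator_iff)
    have vb: "cmod (v j x) \<le> real m * indicator ?b x" for j x
      using v(2,3) by (cases "norm x > r + 1") (auto simp: indicator_def)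
    have v12: "v j \<in> L1_L2" for j
    proof -
      have "integrable lborel (v j)"
        by (rule Bochner_Integration.integrable_bound[OF ib[of "real m"]])
           (auto intro!: order_trans[OF vb])
      moreover have "integrable lborel (\<lambda>x. (cmod (v j x))\<^sup>2)"
      proof (rule Bochner_Integration.integrable_bound[OF ib[of "(real m)\<^sup>2"]])
        show "AE x in lborel. norm ((cmod (v j x))\<^sup>2) \<le> norm ((real m)\<^sup>2 * indicator ?b x :: real)"
        proof (rule AE_I2)
          fix x
          show "norm ((cmod (v j x))\<^sup>2) \<le> norm ((real m)\<^sup>2 * indicator ?b x :: real)"
            using power_mono[OF v(2)[of j x] norm_ge_zero, of 2] v(3)[of x j] by (cases "norm x > r + 1") auto
        qed
      qed measurable
      ultimately show ?thesis by (simp add: L1_L2_def)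
    qed
    show "sqnorm (w m) \<le> sqnorm (fourier (w m))"
    proof (rule fourier_sqnorm_ge_limit[OF w12 v12])
      show "sqnorm (v j) \<le> sqnorm (fourier (v j))" for j
        by (rule fourier_sqnorm_ge_continuous[OF v12 v(1,2)])
      have "(\<lambda>j. sqnorm (\<lambda>x. w m x - v j x)) \<longlonglongrightarrow> (LINT x::'a|lborel. 0)"
      proof (rule integral_dominated_convergence[where w = "\<lambda>x. (2 * real m)\<^sup>2 * indicator ?b x"])
        show "AE x in lborel. (\<lambda>j. (cmod (w m x - v j x))\<^sup>2) \<longlonglongrightarrow> 0"
          using v(4)
        proof eventually_elim
          case (elim x)
          have "(\<lambda>j. (cmod (w m x - v j x))\<^sup>2) \<longlonglongrightarrow> (cmod (w m x - w m x))\<^sup>2"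
            by (intro tendsto_intros elim)
          then show ?case by simp
        qed
        show "AE x in lborel. norm ((cmod (w m x - v j x))\<^sup>2) \<le> (2 * real m)\<^sup>2 * indicator ?b x" for j
        proof (rule AE_I2)
          fix x
          have "cmod (w m x - v j x) \<le> 2 * m"
            using norm_triangle_ineq4[of "w m x" "v j x"] wB[of x] v(2)[of j x] by linarith
          then have "(cmod (w m x - v j x))\<^sup>2 \<le> (2 * real m)\<^sup>2" by (intro power_mono) auto
          moreover have "norm x > r + 1 \<Longrightarrow> w m x - v j x = 0" using wr v(3) by simp
          ultimately show "norm ((cmod (w m x - v j x))\<^sup>2) \<le> (2 * real m)\<^sup>2 * indicator ?b x"
            by (cases "norm x > r + 1") (auto simp: indicator_def)
        qed
      qed (use ib in auto)
      then show "(\<lambda>j. sqnorm (\<lambda>x. w m x - v j x)) \<longlonglongrightarrow> 0" by simp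
    qed
  qed
qed

section \<open>The spectral density in Fourier space\<close>

text \<open>One sesquilinear calculus serves twice: with weight 1 for the inner product of functions
  on \<open>D\<close>, with weight \<open>norm\<close> for the energy in Fourier space. It works
  with functions instead of classes, so \<open>form\<close> is only semidefinite.\<close>

locale weighted_L2 =
  fixes h :: "'a::euclidean_space \<Rightarrow> real"
  assumes h_measurable [measurable]: "h \<in> borel_measurable borel"
    and h_nonneg: "0 \<le> h x"
begin

definition carrier :: "('a \<Rightarrow> complex) set" where
  "carrier = {f \<in> borel_measurable borel. integrable lborel (\<lambda>x. h x * (cmod (f x))\<^sup>2)}"

definition form :: "('a \<Rightarrow> complex) \<Rightarrow> ('a \<Rightarrow> complex) \<Rightarrow> complex" where
  "form f g = (LINT x|lborel. of_real (h x) * (f x * cnj (g x)))"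

lemma form_integrable:
  assumes "f \<in> carrier" "g \<in> carrier"
  shows "integrable lborel (\<lambda>x. of_real (h x) * (f x * cnj (g x)))"
proof (rule Bochner_Integration.integrable_bound)
  have [measurable]: "f \<in> borel_measurable borel" "g \<in> borel_measurable borel"
    using assms by (auto simp: carrier_def)
  show "(\<lambda>x. of_real (h x) * (f x * cnj (g x))) \<in> borel_measurable lborel" by measurable
  show "integrable lborel (\<lambda>x. h x * (cmod (f x))\<^sup>2 + h x * (cmod (g x))\<^sup>2)"
    using assms by (auto simp: carrier_def)
  show "AE x in lborel. norm (of_real (h x) * (f x * cnj (g x))) \<le> norm (h x * (cmod (f x))\<^sup>2 + h x * (cmod (g x))\<^sup>2)"
  proof (rule AE_I2)
    fix x
    have "2 * (cmod (f x) * cmod (g x)) \<le> (cmod (f x))\<^sup>2 + (cmod (g x))\<^sup>2"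
      using sum_squares_bound[of "cmod (f x)" "cmod (g x)"] by simp
    then have "cmod (f x) * cmod (g x) \<le> (cmod (f x))\<^sup>2 + (cmod (g x))\<^sup>2"
      using mult_nonneg_nonneg[OF norm_ge_zero[of "f x"] norm_ge_zero[of "g x"]] by linarith
    then have "h x * (cmod (f x) * cmod (g x)) \<le> h x * ((cmod (f x))\<^sup>2 + (cmod (g x))\<^sup>2)"
      by (intro mult_left_mono h_nonneg)
    then show "norm (of_real (h x) * (f x * cnj (g x))) \<le> norm (h x * (cmod (f x))\<^sup>2 + h x * (cmod (g x))\<^sup>2)"
      using h_nonneg[of x] by (simp add: norm_mult distrib_left)
  qed
qed

lemma carrier_add:
  assumes "f \<in> carrier" "g \<in> carrier"
  shows "(\<lambda>x. f x + g x) \<in> carrier"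
proof -
  have m: "f \<in> borel_measurable borel" "g \<in> borel_measurable borel" using assms by (auto simp: carrier_def)
  have "integrable lborel (\<lambda>x. h x * (cmod (f x + g x))\<^sup>2)"
  proof (rule Bochner_Integration.integrable_bound)
    show "integrable lborel (\<lambda>x. 2 * (h x * (cmod (f x))\<^sup>2) + 2 * (h x * (cmod (g x))\<^sup>2))"
      using assms by (auto simp: carrier_def)
    show "AE x in lborel. norm (h x * (cmod (f x + g x))\<^sup>2) \<le> norm (2 * (h x * (cmod (f x))\<^sup>2) + 2 * (h x * (cmod (g x))\<^sup>2))"
    proof (rule AE_I2)
      fix x
      have "h x * (cmod (f x + g x))\<^sup>2 \<le> h x * (2 * (cmod (f x))\<^sup>2 + 2 * (cmod (g x))\<^sup>2)"
        using cmod_add_sq_le[of 1 "f x" "g x"] by (intro mult_left_mono h_nonneg) simp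
      then show "norm (h x * (cmod (f x + g x))\<^sup>2) \<le> norm (2 * (h x * (cmod (f x))\<^sup>2) + 2 * (h x * (cmod (g x))\<^sup>2))"
        using h_nonneg[of x] by (simp add: algebra_simps)
    qed
  qed (use m in measurable)
  with m show ?thesis by (simp add: carrier_def)
qed

lemma carrier_cmult:
  assumes "f \<in> carrier"
  shows "(\<lambda>x. c * f x) \<in> carrier"
proof -
  have "(\<lambda>x. h x * (cmod (c * f x))\<^sup>2) = (\<lambda>x. (cmod c)\<^sup>2 * (h x * (cmod (f x))\<^sup>2))"
    by (simp add: fun_eq_iff norm_mult power_mult_distrib)
  with assms show ?thesis by (auto simp: carrier_def)
qed

lemma carrier_diff:
  assumes "f \<in> carrier" "g \<in> carrier"
  shows "(\<lambda>x. f x - g x) \<in> carrier"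
  using carrier_add[OF assms(1) carrier_cmult[OF assms(2), of "-1"]] by simp

lemma carrier_sum:
  assumes "\<And>i. i \<in> A \<Longrightarrow> f i \<in> carrier"
  shows "(\<lambda>x. \<Sum>i\<in>A. c i * f i x) \<in> carrier"
  using assms
proof (induction A rule: infinite_finite_induct)
  case (insert i A)
  then show ?case using carrier_add[OF carrier_cmult[of "f i" "c i"]] by simp
qed (auto simp: carrier_def)

lemma form_cnj: "form g f = cnj (form f g)"
  unfolding form_def Bochner_Integration.integral_cnj[symmetric] by (simp add: mult_ac)

lemma form_diff_left:
  assumes "f \<in> carrier" "f' \<in> carrier" "g \<in> carrier"
  shows "form (\<lambda>x. f x - f' x) g = form f g - form f' g"
  using form_integrable[OF assms(1,3)] form_integrable[OF assms(2,3)]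
  by (simp add: form_def left_diff_distrib right_diff_distrib)

lemma form_cmult_left: "form (\<lambda>x. c * f x) g = c * form f g"
proof -
  have "of_real (h x) * (c * f x * cnj (g x)) = c * (of_real (h x) * (f x * cnj (g x)))" for x
    by simp
  then show ?thesis unfolding form_def by (simp only: integral_mult_right_zero)
qed

lemma form_sum_left:
  assumes "\<And>i. i \<in> A \<Longrightarrow> f i \<in> carrier" "g \<in> carrier"
  shows "form (\<lambda>x. \<Sum>i\<in>A. c i * f i x) g = (\<Sum>i\<in>A. c i * form (f i) g)"
proof -
  have "form (\<lambda>x. \<Sum>i\<in>A. c i * f i x) g = (LINT x|lborel. (\<Sum>i\<in>A. of_real (h x) * (c i * f i x * cnj (g x))))"
    unfolding form_def by (simp only: sum_distrib_left sum_distrib_right)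
  also have "\<dots> = (\<Sum>i\<in>A. form (\<lambda>x. c i * f i x) g)"
    unfolding form_def by (rule Bochner_Integration.integral_sum) (intro form_integrable carrier_cmult assms)
  finally show ?thesis by (simp only: form_cmult_left)
qed

lemma form_diff_right:
  assumes "f \<in> carrier" "g \<in> carrier" "g' \<in> carrier"
  shows "form f (\<lambda>x. g x - g' x) = form f g - form f g'"
  by (subst (1 2 3) form_cnj) (simp add: form_diff_left[OF assms(2,3,1)])

lemma form_cmult_right: "form f (\<lambda>x. c * g x) = cnj c * form f g"
  by (subst (1 2) form_cnj) (simp add: form_cmult_left)

lemma form_sum_right:
  assumes "\<And>i. i \<in> A \<Longrightarrow> g i \<in> carrier" "f \<in> carrier"
  shows "form f (\<lambda>x. \<Sum>i\<in>A. c i * g i x) = (\<Sum>i\<in>A. cnj (c i) * form f (g i))"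
  by (subst form_cnj) (simp add: form_sum_left[OF assms] form_cnj[of f, symmetric])

lemma form_self: "form f f = of_real (LINT x|lborel. h x * (cmod (f x))\<^sup>2)"
  by (simp only: form_def complex_norm_square[symmetric] of_real_mult[symmetric] integral_complex_of_real)

lemma bessel:
  assumes "finite J" and u: "\<And>j. j \<in> J \<Longrightarrow> u j \<in> carrier" and e: "e \<in> carrier"
    and on: "\<And>i j. i \<in> J \<Longrightarrow> j \<in> J \<Longrightarrow> form (u i) (u j) = (if i = j then 1 else 0)"
  shows "(\<Sum>j\<in>J. (cmod (form e (u j)))\<^sup>2) \<le> (LINT x|lborel. h x * (cmod (e x))\<^sup>2)"
proof -
  define c where "c = (\<lambda>j. form e (u j))"
  define p where "p = (\<lambda>x. \<Sum>j\<in>J. c j * u j x)"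
  have p: "p \<in> carrier" unfolding p_def by (rule carrier_sum[OF u])
  have S: "(\<Sum>j\<in>J. of_real ((cmod (c j))\<^sup>2)) = (\<Sum>j\<in>J. c j * cnj (c j))"
    by (simp only: complex_norm_square)
  have pu: "form p (u j) = c j" if "j \<in> J" for j
  proof -
    have "form p (u j) = (\<Sum>i\<in>J. c i * form (u i) (u j))"
      unfolding p_def by (rule form_sum_left[OF u u[OF that]])
    also have "\<dots> = (\<Sum>i\<in>J. if i = j then c i else 0)" using that by (intro sum.cong) (auto simp: on)
    finally show ?thesis using that assms(1) by simp
  qed
  have ep: "form f p = (\<Sum>j\<in>J. c j * cnj (c j))" if "f \<in> carrier" "\<And>j. j \<in> J \<Longrightarrow> form f (u j) = c j" for f
  proof -
    have "form f p = (\<Sum>j\<in>J. cnj (c j) * form f (u j))"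
      unfolding p_def by (rule form_sum_right[OF u that(1)])
    also have "\<dots> = (\<Sum>j\<in>J. c j * cnj (c j))" using that(2) by (intro sum.cong) auto
    finally show ?thesis .
  qed
  have "0 \<le> (LINT x|lborel. h x * (cmod (e x - p x))\<^sup>2)"
    using h_nonneg by (intro integral_nonneg_AE) auto
  moreover have "form (\<lambda>x. e x - p x) (\<lambda>x. e x - p x) = form e e - form e p - (form p e - form p p)"
    using p e carrier_diff[OF e p] by (simp add: form_diff_left form_diff_right)
  moreover have "form e p = (\<Sum>j\<in>J. of_real ((cmod (c j))\<^sup>2))" "form p p = (\<Sum>j\<in>J. of_real ((cmod (c j))\<^sup>2))"
    unfolding S using ep[OF e] ep[OF p] pu by (auto simp: c_def)
  moreover have "form p e = (\<Sum>j\<in>J. of_real ((cmod (c j))\<^sup>2))"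
    by (subst form_cnj) (simp add: calculation(3))
  ultimately have "of_real (LINT x|lborel. h x * (cmod (e x - p x))\<^sup>2) =
      complex_of_real ((LINT x|lborel. h x * (cmod (e x))\<^sup>2) - (\<Sum>j\<in>J. (cmod (c j))\<^sup>2))"
    unfolding form_self by simp
  then have "(LINT x|lborel. h x * (cmod (e x - p x))\<^sup>2) = (LINT x|lborel. h x * (cmod (e x))\<^sup>2) - (\<Sum>j\<in>J. (cmod (c j))\<^sup>2)"
    by (simp only: of_real_eq_iff)
  with \<open>0 \<le> _\<close> show ?thesis by (simp add: c_def)
qed

end

section \<open>Bessel's inequality for plane waves on \<open>D\<close>\<close>

interpretation L2: weighted_L2 "\<lambda>_. 1"
  by unfold_locales auto

lemma L2_inner_form: "L2_inner u v = L2.form u v"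
  by (simp add: L2_inner_def L2.form_def)

lemma L2_in_carrier: "u \<in> L2 D \<Longrightarrow> u \<in> L2.carrier"
  by (simp add: L2_def L2.carrier_def)

definition moment :: "('a::euclidean_space) set \<Rightarrow> 'a \<Rightarrow> real" where
  "moment D a = (LINT x:D|lborel. (norm (x - a))\<^sup>2)"

text \<open>The centre \<open>a\<close> changes the pairing with \<open>u\<close> only by a phase,
  but makes differences of two waves small near \<open>a\<close>, which is how the moment about
  \<open>a\<close> enters.\<close>

definition plane_wave :: "('a::euclidean_space) set \<Rightarrow> 'a \<Rightarrow> 'a \<Rightarrow> 'a \<Rightarrow> complex" where
  "plane_wave D a \<xi> x = indicator D x * exp (\<i> * of_real ((x - a) \<bullet> \<xi>))"

context
  fixes D :: "('a::euclidean_space) set"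
  assumes D: "bounded D" "open D"
begin

lemma emeasure_D: "emeasure lborel D < \<infinity>"
  using emeasure_bounded_finite[OF D(1)] D(2) by simp

lemma D_sets [measurable]: "D \<in> sets borel"
  using D(2) by simp

lemma moment_integrable: "integrable lborel (\<lambda>x. indicator D x * (norm (x - a))\<^sup>2)"
proof -
  obtain r where r: "D \<subseteq> ball a r" using bounded_subset_ballD[OF D(1), of a] by blast
  show ?thesis
  proof (rule Bochner_Integration.integrable_bound)
    show "integrable lborel (\<lambda>x. r\<^sup>2 * indicator D x)"
      using emeasure_D by (intro integrable_mult_right) (simp add: integrable_indicator_iff)
    show "AE x in lborel. norm (indicator D x * (norm (x - a))\<^sup>2) \<le> norm (r\<^sup>2 * indicator D x)"
    proof (rule AE_I2)
      fix x show "norm (indicator D x * (norm (x - a))\<^sup>2) \<le> norm (r\<^sup>2 * indicator D x)"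
      proof (cases "x \<in> D")
        case True
        then have "norm (x - a) \<le> r" using r by (force simp: dist_norm norm_minus_commute)
        then show ?thesis using True by (simp add: power_mono)
      qed simp
    qed
  qed measurable
qed

lemma moment_eq: "moment D a = (LINT x|lborel. indicator D x * (norm (x - a))\<^sup>2)"
  by (simp add: moment_def set_lebesgue_integral_def)

lemma plane_wave_L2: "plane_wave D a \<xi> \<in> L2 D"
proof -
  have "integrable lborel (\<lambda>x. (cmod (plane_wave D a \<xi> x))\<^sup>2)"
  proof (rule Bochner_Integration.integrable_bound)
    show "integrable lborel (indicator D :: 'a \<Rightarrow> real)"
      using emeasure_D by (simp add: integrable_indicator_iff)
  qed (auto simp: plane_wave_def norm_mult indicator_def)
  then show ?thesis by (auto simp: L2_def plane_wave_def[abs_def])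
qed

lemma plane_wave_sqnorm: "sqnorm (plane_wave D a \<xi>) = Vol D"
proof -
  have "(cmod (plane_wave D a \<xi> x))\<^sup>2 = indicator D x" for x
    by (auto simp: plane_wave_def norm_mult indicator_def)
  then show ?thesis using emeasure_D by (simp add: Vol_def)
qed

text \<open>Pointwise, \<open>|e^(is) - e^(it)| \<le> |s - t|\<close> (the Taylor remainder of order
  0) and the Cauchy-Schwarz inequality give the factor
  \<open>norm (x - a) * norm (\<xi> - \<eta>)\<close>.\<close>

lemma plane_wave_diff_sqnorm:
  "sqnorm (\<lambda>x. plane_wave D a \<xi> x - plane_wave D a \<eta> x) \<le> (norm (\<xi> - \<eta>))\<^sup>2 * moment D a"
proof -
  have "sqnorm (\<lambda>x. plane_wave D a \<xi> x - plane_wave D a \<eta> x) \<le>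
      (LINT x|lborel. (norm (\<xi> - \<eta>))\<^sup>2 * (indicator D x * (norm (x - a))\<^sup>2))"
  proof (rule integral_mono')
    fix x
    have "cmod (iexp ((x - a) \<bullet> \<xi>) - iexp ((x - a) \<bullet> \<eta>)) = cmod (iexp ((x - a) \<bullet> \<eta>) * (iexp ((x - a) \<bullet> (\<xi> - \<eta>)) - 1))"
    proof -
      have "iexp s - iexp t = iexp t * (iexp (s - t) - 1)" for s t
        by (simp add: right_diff_distrib exp_diff)
      then show ?thesis by (simp only: inner_diff_right)
    qed
    also have "\<dots> = cmod (iexp ((x - a) \<bullet> (\<xi> - \<eta>)) - 1)" by (simp add: norm_mult)
    also have "\<dots> \<le> \<bar>(x - a) \<bullet> (\<xi> - \<eta>)\<bar>" using iexp_approx1[of "(x - a) \<bullet> (\<xi> - \<eta>)" 0] by simp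
    also have "\<dots> \<le> norm (x - a) * norm (\<xi> - \<eta>)" by (rule Cauchy_Schwarz_ineq2)
    finally have "(cmod (iexp ((x - a) \<bullet> \<xi>) - iexp ((x - a) \<bullet> \<eta>)))\<^sup>2 \<le> (norm (x - a) * norm (\<xi> - \<eta>))\<^sup>2"
      by (intro power_mono) auto
    then show "(cmod (plane_wave D a \<xi> x - plane_wave D a \<eta> x))\<^sup>2 \<le> (norm (\<xi> - \<eta>))\<^sup>2 * (indicator D x * (norm (x - a))\<^sup>2)"
      by (auto simp: plane_wave_def indicator_def power_mult_distrib mult.commute)
  qed (use moment_integrable in auto)
  also have "\<dots> = (norm (\<xi> - \<eta>))\<^sup>2 * moment D a" by (simp add: moment_eq)
  finally show ?thesis .
qed

lemma fourier_plane_wave: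
  assumes "u \<in> L2 D"
  shows "(cmod (fourier u \<xi>))\<^sup>2 = (2 * pi) powr (- real DIM('a)) * (cmod (L2.form (plane_wave D a \<xi>) u))\<^sup>2"
proof -
  have eq: "of_real 1 * (u x * cnj (plane_wave D a \<xi> x)) = exp (\<i> * of_real (a \<bullet> \<xi>)) * (wave (x \<bullet> \<xi>) * u x)" for x
    using assms by (cases "x \<in> D") (auto simp: plane_wave_def L2_def exp_cnj inner_diff_left exp_diff exp_minus field_simps)
  have "L2.form u (plane_wave D a \<xi>) = exp (\<i> * of_real (a \<bullet> \<xi>)) * (LINT x|lborel. wave (x \<bullet> \<xi>) * u x)"
    unfolding L2.form_def eq by (rule integral_mult_right_zero)
  then show ?thesis
    unfolding norm_fourier_sq by (subst L2.form_cnj) (simp add: norm_mult)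
qed

context
  fixes J :: "'j set" and u :: "'j \<Rightarrow> 'a \<Rightarrow> complex"
  assumes J: "finite J" and u: "\<And>j. j \<in> J \<Longrightarrow> u j \<in> L2 D"
    and on: "\<And>i j. i \<in> J \<Longrightarrow> j \<in> J \<Longrightarrow> L2_inner (u i) (u j) = (if i = j then 1 else 0)"
begin

lemma bessel_L2:
  assumes "e \<in> L2.carrier"
  shows "(\<Sum>j\<in>J. (cmod (L2.form e (u j)))\<^sup>2) \<le> sqnorm e"
  using L2.bessel[OF J L2_in_carrier[OF u] assms] on by (simp add: L2_inner_form)

lemma fourier_density_bound: "(\<Sum>j\<in>J. (cmod (fourier (u j) \<xi>))\<^sup>2) \<le> (2 * pi) powr (- real DIM('a)) * Vol D"
proof -
  have "(\<Sum>j\<in>J. (cmod (fourier (u j) \<xi>))\<^sup>2) =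
      (2 * pi) powr (- real DIM('a)) * (\<Sum>j\<in>J. (cmod (L2.form (plane_wave D 0 \<xi>) (u j)))\<^sup>2)"
    using fourier_plane_wave[OF u, of _ \<xi> 0] by (simp add: sum_distrib_left)
  also have "\<dots> \<le> (2 * pi) powr (- real DIM('a)) * Vol D"
    using bessel_L2[OF L2_in_carrier[OF plane_wave_L2]] by (intro mult_left_mono) (auto simp: plane_wave_sqnorm)
  finally show ?thesis .
qed

text \<open>Each difference of squares factors as \<open>(f - g) * (f + g)\<close>. The
  Cauchy-Schwarz inequality over \<open>J\<close>, with \<open>L2_set\<close> the Euclidean norm of
  a finite family, leaves three sums for Bessel's inequality: one for the difference of the waves
  and one for each wave. The latter two produce the factor 2.\<close>

lemma fourier_density_lipschitz_moment:
  "\<bar>(\<Sum>j\<in>J. (cmod (fourier (u j) \<xi>))\<^sup>2) - (\<Sum>j\<in>J. (cmod (fourier (u j) \<eta>))\<^sup>2)\<bar>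
    \<le> 2 * (2 * pi) powr (- real DIM('a)) * sqrt (Vol D * moment D a) * norm (\<xi> - \<eta>)"
proof -
  let ?c = "(2 * pi) powr (- real DIM('a))"
  define f where "f = (\<lambda>j. cmod (L2.form (plane_wave D a \<xi>) (u j)))"
  define g where "g = (\<lambda>j. cmod (L2.form (plane_wave D a \<eta>) (u j)))"
  define d where "d = (\<lambda>j. cmod (L2.form (\<lambda>x. plane_wave D a \<xi> x - plane_wave D a \<eta> x) (u j)))"
  note pw = L2_in_carrier[OF plane_wave_L2]
  have "(\<Sum>j\<in>J. (f j)\<^sup>2) \<le> Vol D" "(\<Sum>j\<in>J. (g j)\<^sup>2) \<le> Vol D"
    unfolding f_def g_def using bessel_L2[OF pw] by (auto simp: plane_wave_sqnorm)
  then have fg: "L2_set f J \<le> sqrt (Vol D)" "L2_set g J \<le> sqrt (Vol D)"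
    unfolding L2_set_def by auto
  have "(\<Sum>j\<in>J. (d j)\<^sup>2) \<le> (norm (\<xi> - \<eta>))\<^sup>2 * moment D a"
    unfolding d_def by (rule order_trans[OF bessel_L2 plane_wave_diff_sqnorm]) (intro L2.carrier_diff pw)
  then have "L2_set d J \<le> sqrt ((norm (\<xi> - \<eta>))\<^sup>2 * moment D a)"
    unfolding L2_set_def by (rule real_sqrt_le_mono)
  then have dd: "L2_set d J \<le> norm (\<xi> - \<eta>) * sqrt (moment D a)"
    by (simp add: real_sqrt_mult)
  have diff: "\<bar>f j - g j\<bar> \<le> d j" if "j \<in> J" for j
    unfolding f_def g_def d_def using norm_triangle_ineq3
    by (simp add: L2.form_diff_left[OF pw pw L2_in_carrier[OF u[OF that]]])
  have nn: "0 \<le> f j" "0 \<le> g j" "0 \<le> d j" for j by (auto simp: f_def g_def d_def)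
  have "\<bar>(\<Sum>j\<in>J. (f j)\<^sup>2) - (\<Sum>j\<in>J. (g j)\<^sup>2)\<bar> = \<bar>\<Sum>j\<in>J. (f j - g j) * (f j + g j)\<bar>"
    by (simp add: sum_subtractf[symmetric] power2_eq_square algebra_simps)
  also have "\<dots> \<le> (\<Sum>j\<in>J. \<bar>d j\<bar> * \<bar>f j\<bar> + \<bar>d j\<bar> * \<bar>g j\<bar>)"
  proof (rule order_trans[OF sum_abs sum_mono])
    fix j assume "j \<in> J"
    then have "\<bar>f j - g j\<bar> * (f j + g j) \<le> d j * (f j + g j)" using diff nn by (intro mult_right_mono) auto
    then show "\<bar>(f j - g j) * (f j + g j)\<bar> \<le> \<bar>d j\<bar> * \<bar>f j\<bar> + \<bar>d j\<bar> * \<bar>g j\<bar>"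
      using nn[of j] unfolding abs_mult by (simp add: distrib_left)
  qed
  also have "\<dots> \<le> L2_set d J * L2_set f J + L2_set d J * L2_set g J"
    unfolding sum.distrib by (intro add_mono L2_set_mult_ineq)
  also have "\<dots> \<le> (norm (\<xi> - \<eta>) * sqrt (moment D a)) * sqrt (Vol D) + (norm (\<xi> - \<eta>) * sqrt (moment D a)) * sqrt (Vol D)"
    using dd fg by (intro add_mono mult_mono) (auto simp: moment_eq intro!: mult_nonneg_nonneg integral_nonneg_AE)
  finally have main: "\<bar>(\<Sum>j\<in>J. (f j)\<^sup>2) - (\<Sum>j\<in>J. (g j)\<^sup>2)\<bar> \<le> 2 * sqrt (Vol D * moment D a) * norm (\<xi> - \<eta>)"
    by (simp add: real_sqrt_mult mult_ac)
  have F: "(\<Sum>j\<in>J. (cmod (fourier (u j) \<zeta>))\<^sup>2) = ?c * (\<Sum>j\<in>J. (cmod (L2.form (plane_wave D a \<zeta>) (u j)))\<^sup>2)" for \<zeta>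
    using fourier_plane_wave[OF u, of _ \<zeta> a] by (simp add: sum_distrib_left)
  have "\<bar>(\<Sum>j\<in>J. (cmod (fourier (u j) \<xi>))\<^sup>2) - (\<Sum>j\<in>J. (cmod (fourier (u j) \<eta>))\<^sup>2)\<bar> =
      ?c * \<bar>(\<Sum>j\<in>J. (f j)\<^sup>2) - (\<Sum>j\<in>J. (g j)\<^sup>2)\<bar>"
    unfolding F f_def g_def by (simp add: right_diff_distrib[symmetric] abs_mult)
  also have "\<dots> \<le> ?c * (2 * sqrt (Vol D * moment D a) * norm (\<xi> - \<eta>))"
    by (intro mult_left_mono main) auto
  finally show ?thesis by (simp add: mult_ac)
qed

end

text \<open>Wherever \<open>a\<close> lies, the ball of radius \<open>r\<close> about it covers at
  most half of the volume of \<open>D\<close>; the other half contributes at least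
  \<open>r^2\<close> per unit of volume.\<close>

lemma moment_lower:
  assumes r: "r \<ge> 0" and half: "unit_ball_vol DIM('a) * r ^ DIM('a) \<le> Vol D / 2"
  shows "r\<^sup>2 * (Vol D / 2) \<le> moment D a"
proof -
  let ?A = "D - ball a r"
  have "measure lborel (ball a r) = unit_ball_vol DIM('a) * r ^ DIM('a)"
    using emeasure_ball_unit_ball_vol[OF r, of a] r by (simp add: measure_def)
  moreover have "measure lborel D \<le> measure lborel (?A \<union> ball a r)"
    using emeasure_D emeasure_lborel_ball_finite[of a r]
    by (intro measure_mono_fmeasurable) (auto simp: fmeasurable_def intro!: le_less_trans[OF emeasure_subadditive])
  moreover have "measure lborel (?A \<union> ball a r) \<le> measure lborel ?A + measure lborel (ball a r)"
    by (rule measure_Un_le) auto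
  ultimately have A: "Vol D / 2 \<le> measure lborel ?A" using half by (simp add: Vol_def)
  have fin: "emeasure lborel ?A < \<infinity>"
    using emeasure_mono[of ?A D lborel] emeasure_D by (auto intro: le_less_trans)
  have "r\<^sup>2 * (Vol D / 2) \<le> r\<^sup>2 * measure lborel ?A" using A by (intro mult_left_mono) auto
  also have "\<dots> = (LINT x|lborel. r\<^sup>2 * indicator ?A x)" using fin by simp
  also have "\<dots> \<le> moment D a" unfolding moment_eq
  proof (rule integral_mono'[OF moment_integrable])
    fix x show "r\<^sup>2 * indicator ?A x \<le> indicator D x * (norm (x - a))\<^sup>2"
      using r by (auto simp: indicator_def dist_norm norm_minus_commute intro!: power_mono)
  qed auto
  finally show ?thesis .
qed

end

section \<open>Orthonormal eigenfunctions\<close>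

context weighted_L2
begin

text \<open>The result is a matrix of coefficients, so that the new functions are visibly
  combinations of the old ones, as membership in a span requires. Independence is expressed through
  \<open>form\<close>, which fits a semidefinite form.\<close>

lemma gram_schmidt:
  assumes "\<And>i. i < m \<Longrightarrow> \<phi> i \<in> carrier"
    and "\<And>c. form (\<lambda>x. \<Sum>i<m. c i * \<phi> i x) (\<lambda>x. \<Sum>i<m. c i * \<phi> i x) = 0 \<Longrightarrow> \<forall>i<m. c i = 0"
  shows "\<exists>a :: nat \<Rightarrow> nat \<Rightarrow> complex. \<forall>i<m. \<forall>j<m.
    form (\<lambda>x. \<Sum>l<m. a i l * \<phi> l x) (\<lambda>x. \<Sum>l<m. a j l * \<phi> l x) = (if i = j then 1 else 0)"
  using assms
proof (induction m)
  case (Suc m)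
  have "\<exists>a :: nat \<Rightarrow> nat \<Rightarrow> complex. \<forall>i<m. \<forall>j<m.
    form (\<lambda>x. \<Sum>l<m. a i l * \<phi> l x) (\<lambda>x. \<Sum>l<m. a j l * \<phi> l x) = (if i = j then 1 else 0)"
  proof (rule Suc.IH)
    fix c assume *: "form (\<lambda>x. \<Sum>i<m. c i * \<phi> i x) (\<lambda>x. \<Sum>i<m. c i * \<phi> i x) = 0"
    \<comment> \<open>A null combination of the first \<open>m\<close> functions is one of all
      \<open>Suc m\<close> with last coefficient 0.\<close>
    have "(\<Sum>i<Suc m. (c(m := 0)) i * \<phi> i x) = (\<Sum>i<m. c i * \<phi> i x)" for x by simp
    then have "form (\<lambda>x. \<Sum>i<Suc m. (c(m := 0)) i * \<phi> i x) (\<lambda>x. \<Sum>i<Suc m. (c(m := 0)) i * \<phi> i x) = 0"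
      using * by (simp only:)
    from Suc.prems(2)[OF this] have "(c(m := 0)) i = 0" if "i < m" for i
      using less_SucI[OF that] by blast
    then show "\<forall>i<m. c i = 0" by (simp split: if_splits)
  qed (use Suc.prems in auto)
  then obtain a :: "nat \<Rightarrow> nat \<Rightarrow> complex" where a: "\<And>i j. i < m \<Longrightarrow> j < m \<Longrightarrow>
    form (\<lambda>x. \<Sum>l<m. a i l * \<phi> l x) (\<lambda>x. \<Sum>l<m. a j l * \<phi> l x) = (if i = j then 1 else 0)" by auto
  define \<psi> where "\<psi> = (\<lambda>i x. \<Sum>l<m. a i l * \<phi> l x)"
  have \<psi>: "\<psi> i \<in> carrier" for i unfolding \<psi>_def using Suc.prems(1) by (intro carrier_sum) auto
  have \<phi>m: "\<phi> m \<in> carrier" using Suc.prems(1) by simp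
  define p where "p = (\<lambda>x. \<Sum>i<m. form (\<phi> m) (\<psi> i) * \<psi> i x)"
  define w where "w = (\<lambda>x. \<phi> m x - p x)"
  \<comment> \<open>The coefficients of the residual \<open>w\<close> in terms of
    \<open>\<phi>\<close>. The last one is 1, so independence prevents \<open>form w w\<close> from
    vanishing.\<close>
  define b where "b = (\<lambda>l. if l = m then 1 else - (\<Sum>i<m. form (\<phi> m) (\<psi> i) * a i l))"
  have p: "p \<in> carrier" unfolding p_def by (intro carrier_sum \<psi>)
  have w: "w \<in> carrier" unfolding w_def by (intro carrier_diff \<phi>m p)
  have wb: "w = (\<lambda>x. \<Sum>l<Suc m. b l * \<phi> l x)"
  proof
    fix x
    have "p x = (\<Sum>l<m. \<Sum>i<m. form (\<phi> m) (\<psi> i) * (a i l * \<phi> l x))"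
      unfolding p_def \<psi>_def sum_distrib_left by (rule sum.swap)
    also have "\<dots> = - (\<Sum>l<m. b l * \<phi> l x)"
      by (simp add: b_def sum_negf[symmetric] sum_distrib_right mult.assoc)
    finally show "w x = (\<Sum>l<Suc m. b l * \<phi> l x)" by (simp add: w_def b_def)
  qed
  have orth: "form w (\<psi> j) = 0" if "j < m" for j
  proof -
    have "form p (\<psi> j) = (\<Sum>i<m. form (\<phi> m) (\<psi> i) * form (\<psi> i) (\<psi> j))"
      unfolding p_def by (intro form_sum_left \<psi>)
    also have "\<dots> = (\<Sum>i<m. if i = j then form (\<phi> m) (\<psi> i) else 0)"
      using a that by (intro sum.cong) (auto simp: \<psi>_def)
    also have "\<dots> = form (\<phi> m) (\<psi> j)" using that by simp
    finally show ?thesis unfolding w_def using form_diff_left[OF \<phi>m p \<psi>] by simp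
  qed
  define r where "r = (LINT x|lborel. h x * (cmod (w x))\<^sup>2)"
  have "form w w \<noteq> 0"
  proof
    assume "form w w = 0"
    then have "\<forall>i<Suc m. b i = 0" unfolding wb by (rule Suc.prems(2))
    then show False by (auto simp: b_def)
  qed
  moreover have "r \<ge> 0" unfolding r_def using h_nonneg by (intro integral_nonneg_AE) auto
  ultimately have r: "r > 0" "form w w = of_real r" by (auto simp: form_self r_def)
  define s where "s = complex_of_real (1 / sqrt r)"
  have s: "s * (cnj s * of_real r) = 1"
    using r(1) by (simp add: s_def flip: of_real_mult)
  \<comment> \<open>The old rows are unspecified in column \<open>m\<close>, where they must be
    reset to 0.\<close>
  define a' where "a' = (\<lambda>i l. if i < m then (if l < m then a i l else 0) else s * b l)"
  have psi_eq: "(\<lambda>x. \<Sum>l<Suc m. a' i l * \<phi> l x) = \<psi> i" if "i < m" for i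
    using that by (simp add: a'_def \<psi>_def)
  have w_eq: "(\<lambda>x. \<Sum>l<Suc m. a' m l * \<phi> l x) = (\<lambda>x. s * w x)"
    unfolding wb sum_distrib_left by (simp add: a'_def mult.assoc)
  have wo: "form (\<psi> j) w = 0" if "j < m" for j using orth[OF that] by (subst form_cnj) simp
  show ?case
  proof (intro exI allI impI)
    fix i j assume "i < Suc m" "j < Suc m"
    then consider "i < m" "j < m" | "i < m" "j = m" | "i = m" "j < m" | "i = m" "j = m" by linarith
    then show "form (\<lambda>x. \<Sum>l<Suc m. a' i l * \<phi> l x) (\<lambda>x. \<Sum>l<Suc m. a' j l * \<phi> l x) = (if i = j then 1 else 0)"
    proof cases
      case 1
      then show ?thesis using a by (simp only: psi_eq) (simp add: \<psi>_def)
    next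
      case 2
      then show ?thesis using wo by (simp only: psi_eq w_eq form_cmult_right) simp
    next
      case 3
      then show ?thesis using orth by (simp only: psi_eq w_eq form_cmult_left) simp
    next
      case 4
      then show ?thesis using r s by (simp only: w_eq form_cmult_left form_cmult_right) simp
    qed
  qed
qed auto

end

section \<open>Energy and orthogonality in the eigenspaces\<close>

interpretation KG: weighted_L2 norm
  by unfold_locales auto

lemma KG_form_eq: "KG_form u v = KG.form (fourier u) (fourier v)"
  by (simp add: KG_form_def KG.form_def)

lemma sqnorm_eq_0:
  assumes "u \<in> borel_measurable borel" "integrable lborel (\<lambda>x. (cmod (u x))\<^sup>2)" "sqnorm u \<le> 0"
  shows "AE x in lborel. u x = 0"
proof -
  have "0 \<le> sqnorm u" by (intro integral_nonneg_AE) auto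
  with assms have "sqnorm u = 0" by simp
  then have "AE x in lborel. (cmod (u x))\<^sup>2 = 0"
    using assms(2) by (subst (asm) integral_nonneg_eq_0_iff_AE) auto
  then show ?thesis by eventually_elim simp
qed

lemma L2_inner_self: "L2_inner u u = of_real (sqnorm u)"
  using L2.form_self[of u] by (simp add: L2_inner_form)

lemma fourier_sum:
  assumes "\<And>i. i \<in> A \<Longrightarrow> integrable lborel (\<phi> i)"
  shows "fourier (\<lambda>x. \<Sum>i\<in>A. c i * \<phi> i x) = (\<lambda>\<xi>. \<Sum>i\<in>A. c i * fourier (\<phi> i) \<xi>)"
proof
  fix \<xi>
  have "(LINT x|lborel. wave (x \<bullet> \<xi>) * (\<Sum>i\<in>A. c i * \<phi> i x)) = (LINT x|lborel. (\<Sum>i\<in>A. c i * (wave (x \<bullet> \<xi>) * \<phi> i x)))"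
    by (simp add: sum_distrib_left mult.left_commute)
  also have "\<dots> = (\<Sum>i\<in>A. LINT x|lborel. c i * (wave (x \<bullet> \<xi>) * \<phi> i x))"
    using assms by (intro Bochner_Integration.integral_sum integrable_mult_right integrable_wave_mult) auto
  also have "\<dots> = (\<Sum>i\<in>A. c i * (LINT x|lborel. wave (x \<bullet> \<xi>) * \<phi> i x))"
    by (simp only: integral_mult_right_zero)
  finally show "fourier (\<lambda>x. \<Sum>i\<in>A. c i * \<phi> i x) \<xi> = (\<Sum>i\<in>A. c i * fourier (\<phi> i) \<xi>)"
    by (simp add: fourier_def sum_distrib_left mult.left_commute)
qed

lemma KG_eigenspace_D:
  assumes "u \<in> KG_eigenspace D \<mu>"
  shows "u \<in> form_domain D" "u \<in> L2 D"
    and "v \<in> form_domain D \<Longrightarrow> KG_form u v = of_real \<mu> * L2_inner u v"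
proof -
  show "u \<in> form_domain D" using assms by (simp add: KG_eigenspace_def KG_operator_def)
  then show "u \<in> L2 D" by (simp add: form_domain_def)
  show "v \<in> form_domain D \<Longrightarrow> KG_form u v = of_real \<mu> * L2_inner u v"
    using assms L2.form_cmult_left[of "of_real \<mu>" u v]
    by (simp add: KG_eigenspace_def KG_operator_def L2_inner_form)
qed

lemma KG_eigenspace_orthogonal:
  assumes u: "u \<in> KG_eigenspace D \<mu>" and v: "v \<in> KG_eigenspace D \<nu>" and "\<mu> \<noteq> \<nu>"
  shows "L2_inner u v = 0"
proof -
  have "of_real \<mu> * L2_inner u v = KG_form u v"
    using KG_eigenspace_D[OF u] KG_eigenspace_D[OF v] by simp
  also have "\<dots> = cnj (KG_form v u)" unfolding KG_form_eq by (rule KG.form_cnj)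
  also have "\<dots> = of_real \<nu> * cnj (L2_inner v u)"
    using KG_eigenspace_D[OF u] KG_eigenspace_D[OF v] by simp
  also have "cnj (L2_inner v u) = L2_inner u v" unfolding L2_inner_form by (rule L2.form_cnj[symmetric])
  finally show ?thesis using assms(3) by simp
qed

text \<open>A non-integrable energy density would have Bochner integral \<open>0\<close>, which for \<open>\<mu> > 0\<close> forces
  \<open>u = 0\<close>. This makes a proof that the form domain has finite energy unnecessary.\<close>

lemma KG_eigenspace_energy:
  assumes D: "bounded D" and u: "u \<in> KG_eigenspace D \<mu>" and "\<mu> > 0"
  shows "fourier u \<in> KG.carrier"
proof (rule ccontr)
  assume non: "fourier u \<notin> KG.carrier"
  note u12 = L2_imp_L1_L2[OF D KG_eigenspace_D(2)[OF u]]
  have m: "fourier u \<in> borel_measurable borel" using u12 by auto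
  have "\<not> integrable lborel (\<lambda>\<xi>. norm \<xi> * (cmod (fourier u \<xi>))\<^sup>2)"
    using non m by (simp add: KG.carrier_def)
  then have "KG_form u u = 0"
    unfolding KG_form_eq KG.form_self by (simp add: not_integrable_integral_eq)
  then have "sqnorm u = 0"
    using KG_eigenspace_D(3)[OF u KG_eigenspace_D(1)[OF u]] assms(3) by (simp add: L2_inner_self)
  then have "AE \<xi> in lborel. fourier u \<xi> = 0"
    using fourier_sqnorm_le[OF u12] m by (intro sqnorm_eq_0) auto
  then have "AE \<xi> in lborel. norm \<xi> * (cmod (fourier u \<xi>))\<^sup>2 = 0" by eventually_elim simp
  then have "integrable lborel (\<lambda>\<xi>. norm \<xi> * (cmod (fourier u \<xi>))\<^sup>2) = integrable lborel (\<lambda>\<xi>::'a. 0::real)"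
    using m by (intro integrable_cong_AE) auto
  then show False using \<open>\<not> integrable _ _\<close> by simp
qed

text \<open>Orthonormalisation leaves the eigenspace as a set of functions unless the form domain is closed
  under linear combinations. The energy identity needed here extends to the span by sesquilinearity
  alone.\<close>

definition KG_span :: "('a::euclidean_space) set \<Rightarrow> real \<Rightarrow> ('a \<Rightarrow> complex) set" where
  "KG_span D \<mu> = {u. \<exists>(m::nat) \<phi> c. (\<forall>i<m. \<phi> i \<in> KG_eigenspace D \<mu>) \<and> u = (\<lambda>x. \<Sum>i<m. c i * \<phi> i x)}"

lemma KG_span_L2:
  assumes "u \<in> KG_span D \<mu>"
  shows "u \<in> L2 D"
proof -
  obtain m :: nat and \<phi> c where \<phi>: "\<And>i. i < m \<Longrightarrow> \<phi> i \<in> KG_eigenspace D \<mu>" and u: "u = (\<lambda>x. \<Sum>i<m. c i * \<phi> i x)"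
    using assms by (auto simp: KG_span_def)
  have "u \<in> L2.carrier"
    unfolding u by (intro L2.carrier_sum L2_in_carrier[OF KG_eigenspace_D(2)[OF \<phi>]]) auto
  moreover have "u x = 0" if "x \<notin> D" for x
    unfolding u using KG_eigenspace_D(2)[OF \<phi>] that by (intro sum.neutral) (auto simp: L2_def)
  ultimately show ?thesis by (simp add: L2_def L2.carrier_def)
qed

lemma KG_span_energy:
  assumes D: "bounded D" and u: "u \<in> KG_span D \<mu>" and "\<mu> > 0"
  shows "fourier u \<in> KG.carrier" and "KG_form u u = of_real (\<mu> * sqnorm u)"
proof -
  obtain m :: nat and \<phi> c where \<phi>: "\<And>i. i < m \<Longrightarrow> \<phi> i \<in> KG_eigenspace D \<mu>" and u: "u = (\<lambda>x. \<Sum>i<m. c i * \<phi> i x)"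
    using assms by (auto simp: KG_span_def)
  note \<phi>2 = KG_eigenspace_D(2)[OF \<phi>] and e = KG_eigenspace_energy[OF D \<phi> assms(3)]
  have f: "fourier u = (\<lambda>\<xi>. \<Sum>i<m. c i * fourier (\<phi> i) \<xi>)"
    unfolding u by (rule fourier_sum) (use L2_imp_L1_L2[OF D \<phi>2] in auto)
  show fu: "fourier u \<in> KG.carrier"
    unfolding f by (intro KG.carrier_sum e) auto
  have u2: "u \<in> L2.carrier"
    unfolding u by (intro L2.carrier_sum L2_in_carrier[OF \<phi>2]) auto
  \<comment> \<open>The weak equation is available only against members of the form domain, so it is
    applied to the pairs \<open>\<phi> i\<close>, \<open>\<phi> j\<close> and summed in each
    argument; finite energy of every \<open>\<phi> i\<close> justifies the expansions.\<close>
  have *: "KG.form (fourier (\<phi> i)) (fourier u) = of_real \<mu> * L2.form (\<phi> i) u" if "i < m" for i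
  proof -
    have "KG.form (fourier (\<phi> i)) (fourier u) = (\<Sum>j<m. cnj (c j) * KG.form (fourier (\<phi> i)) (fourier (\<phi> j)))"
      unfolding f by (rule KG.form_sum_right) (use e that in auto)
    also have "\<dots> = (\<Sum>j<m. of_real \<mu> * (cnj (c j) * L2.form (\<phi> i) (\<phi> j)))"
      using KG_eigenspace_D(3)[OF \<phi>[OF that] KG_eigenspace_D(1)[OF \<phi>]]
      by (intro sum.cong) (auto simp: KG_form_eq L2_inner_form)
    also have "\<dots> = of_real \<mu> * L2.form (\<phi> i) u"
      unfolding u sum_distrib_left[symmetric]
      by (subst L2.form_sum_right) (use L2_in_carrier[OF \<phi>2] that in auto)
    finally show ?thesis .
  qed
  have "KG_form u u = (\<Sum>i<m. c i * KG.form (fourier (\<phi> i)) (fourier u))"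
    unfolding KG_form_eq by (subst f, rule KG.form_sum_left) (use e fu in auto)
  also have "\<dots> = (\<Sum>i<m. of_real \<mu> * (c i * L2.form (\<phi> i) u))"
    using * by (intro sum.cong) auto
  also have "\<dots> = of_real \<mu> * L2.form u u"
    unfolding sum_distrib_left[symmetric]
    by (subst (2) u, subst L2.form_sum_left) (use L2_in_carrier[OF \<phi>2] u2 in auto)
  finally show "KG_form u u = of_real (\<mu> * sqnorm u)" by (simp add: L2_inner_form[symmetric] L2_inner_self)
qed

lemma KG_span_orthogonal:
  assumes "u \<in> KG_span D \<mu>" "v \<in> KG_span D \<nu>" and "\<mu> \<noteq> \<nu>"
  shows "L2_inner u v = 0"
proof -
  obtain m :: nat and \<phi> c where \<phi>: "\<And>i. i < m \<Longrightarrow> \<phi> i \<in> KG_eigenspace D \<mu>" and u: "u = (\<lambda>x. \<Sum>i<m. c i * \<phi> i x)"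
    using assms by (auto simp: KG_span_def)
  obtain n :: nat and \<theta> d where \<theta>: "\<And>i. i < n \<Longrightarrow> \<theta> i \<in> KG_eigenspace D \<nu>" and v: "v = (\<lambda>x. \<Sum>i<n. d i * \<theta> i x)"
    using assms by (auto simp: KG_span_def)
  note \<phi>2 = L2_in_carrier[OF KG_eigenspace_D(2)[OF \<phi>]] and \<theta>2 = L2_in_carrier[OF KG_eigenspace_D(2)[OF \<theta>]]
  have "L2.form (\<phi> i) v = 0" if "i < m" for i
  proof -
    have "L2.form (\<phi> i) v = (\<Sum>j<n. cnj (d j) * L2.form (\<phi> i) (\<theta> j))"
      unfolding v by (rule L2.form_sum_right) (use \<phi>2 \<theta>2 that in auto)
    also have "\<dots> = 0"
      using KG_eigenspace_orthogonal[OF \<phi>[OF that] \<theta> assms(3)] by (intro sum.neutral) (auto simp: L2_inner_form)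
    finally show ?thesis .
  qed
  moreover have "L2.form u v = (\<Sum>i<m. c i * L2.form (\<phi> i) v)"
    unfolding u by (rule L2.form_sum_left) (use \<phi>2 L2_in_carrier[OF KG_span_L2[OF assms(2)]] in auto)
  ultimately show ?thesis by (simp add: L2_inner_form)
qed

text \<open>Independence modulo null sets matches what orthonormalisation asks for: a combination of
  vanishing norm is zero almost everywhere.\<close>

lemma KG_span_orthonormal_basis:
  assumes "KG_multiplicity D \<mu> m"
  obtains \<psi> where "\<And>i. i < m \<Longrightarrow> \<psi> i \<in> KG_span D \<mu>"
    "\<And>i j. i < m \<Longrightarrow> j < m \<Longrightarrow> L2_inner (\<psi> i) (\<psi> j) = (if i = j then 1 else 0)"
proof -
  obtain \<phi> where \<phi>: "\<And>i. i < m \<Longrightarrow> \<phi> i \<in> KG_eigenspace D \<mu>"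
    and ind: "\<And>c. (AE x in lborel. (\<Sum>i<m. c i * \<phi> i x) = 0) \<Longrightarrow> \<forall>i<m. c i = 0"
    using assms by (auto simp: KG_multiplicity_def)
  have "\<exists>a :: nat \<Rightarrow> nat \<Rightarrow> complex. \<forall>i<m. \<forall>j<m.
    L2.form (\<lambda>x. \<Sum>l<m. a i l * \<phi> l x) (\<lambda>x. \<Sum>l<m. a j l * \<phi> l x) = (if i = j then 1 else 0)"
  proof (rule L2.gram_schmidt)
    show c: "\<phi> i \<in> L2.carrier" if "i < m" for i
      using L2_in_carrier[OF KG_eigenspace_D(2)[OF \<phi>[OF that]]] .
    fix c
    let ?w = "\<lambda>x. \<Sum>i<m. c i * \<phi> i x"
    assume "L2.form ?w ?w = 0"
    then have "sqnorm ?w = 0" by (simp only: L2_inner_form[symmetric] L2_inner_self of_real_eq_0_iff)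
    moreover have "?w \<in> L2.carrier" by (intro L2.carrier_sum c) auto
    ultimately have "AE x in lborel. ?w x = 0" by (intro sqnorm_eq_0) (auto simp: L2.carrier_def)
    then show "\<forall>i<m. c i = 0" by (rule ind)
  qed
  then obtain a :: "nat \<Rightarrow> nat \<Rightarrow> complex" where a: "\<And>i j. i < m \<Longrightarrow> j < m \<Longrightarrow>
    L2.form (\<lambda>x. \<Sum>l<m. a i l * \<phi> l x) (\<lambda>x. \<Sum>l<m. a j l * \<phi> l x) = (if i = j then 1 else 0)" by auto
  show ?thesis
  proof (rule that[of "\<lambda>i x. \<Sum>l<m. a i l * \<phi> l x"])
    show "(\<lambda>x. \<Sum>l<m. a i l * \<phi> l x) \<in> KG_span D \<mu>" for i
      using \<phi> unfolding KG_span_def by blast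
  qed (use a in \<open>simp add: L2_inner_form\<close>)
qed

text \<open>The multiplicities give a basis for each value separately. The indices carrying the
  value \<open>\<mu>\<close> are numbered by a bijection \<open>h \<mu>\<close>, and
  \<open>u j\<close> is the basis vector with number \<open>h (\<Lambda> j) j\<close>.\<close>

lemma KG_orthonormal_eigenfunctions:
  assumes ev: "KG_eigenvalues D \<Lambda>"
  obtains u where "\<And>j. 1 \<le> j \<Longrightarrow> u j \<in> KG_span D (\<Lambda> j)"
    "\<And>i j. 1 \<le> i \<Longrightarrow> 1 \<le> j \<Longrightarrow> L2_inner (u i) (u j) = (if i = j then 1 else 0)"
proof -
  define J where "J = (\<lambda>\<mu>. {j. 1 \<le> j \<and> \<Lambda> j = \<mu>})"
  \<comment> \<open>Finiteness matters because \<open>card\<close> of an infinite set is 0, which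
    would leave no basis vectors to distribute.\<close>
  have fin: "finite (J \<mu>)" for \<mu>
  proof -
    have "\<forall>\<^sub>F j in sequentially. \<Lambda> j > \<mu>"
      using ev by (auto simp: KG_eigenvalues_def filterlim_at_top_dense)
    then obtain N where "\<And>j. j \<ge> N \<Longrightarrow> \<Lambda> j > \<mu>" by (auto simp: eventually_sequentially)
    then have "J \<mu> \<subseteq> {..<N}" by (force simp: J_def not_less[symmetric])
    then show ?thesis by (rule finite_subset) simp
  qed
  have mult: "KG_multiplicity D \<mu> (card (J \<mu>))" for \<mu> using ev by (simp add: KG_eigenvalues_def J_def)
  have "\<exists>\<psi>. (\<forall>i<card (J \<mu>). \<psi> i \<in> KG_span D \<mu>) \<and>
      (\<forall>i<card (J \<mu>). \<forall>j<card (J \<mu>). L2_inner (\<psi> i) (\<psi> j) = (if i = j then 1 else 0))" for \<mu>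
    using KG_span_orthonormal_basis[OF mult[of \<mu>]] by metis
  then obtain \<psi> where \<psi>: "\<And>\<mu> i. i < card (J \<mu>) \<Longrightarrow> \<psi> \<mu> i \<in> KG_span D \<mu>"
    "\<And>\<mu> i j. i < card (J \<mu>) \<Longrightarrow> j < card (J \<mu>) \<Longrightarrow> L2_inner (\<psi> \<mu> i) (\<psi> \<mu> j) = (if i = j then 1 else 0)"
    by metis
  have "\<exists>h. bij_betw h (J \<mu>) {0..<card (J \<mu>)}" for \<mu> by (rule ex_bij_betw_finite_nat[OF fin])
  then obtain h where h: "\<And>\<mu>. bij_betw (h \<mu>) (J \<mu>) {0..<card (J \<mu>)}" by metis
  have hj: "h (\<Lambda> j) j < card (J (\<Lambda> j))" if "1 \<le> j" for j
    using bij_betwE[OF h[of "\<Lambda> j"]] that by (auto simp: J_def)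
  show ?thesis
  proof (rule that[of "\<lambda>j. \<psi> (\<Lambda> j) (h (\<Lambda> j) j)"])
    show "\<psi> (\<Lambda> j) (h (\<Lambda> j) j) \<in> KG_span D (\<Lambda> j)" if "1 \<le> j" for j
      using \<psi>(1) hj[OF that] by simp
    fix i j :: nat assume ij: "1 \<le> i" "1 \<le> j"
    show "L2_inner (\<psi> (\<Lambda> i) (h (\<Lambda> i) i)) (\<psi> (\<Lambda> j) (h (\<Lambda> j) j)) = (if i = j then 1 else 0)"
    proof (cases "\<Lambda> i = \<Lambda> j")
      case True
      have "h (\<Lambda> j) i = h (\<Lambda> j) j \<longleftrightarrow> i = j"
        using bij_betw_imp_inj_on[OF h[of "\<Lambda> j"]] ij True by (auto simp: J_def inj_on_def)
      then show ?thesis using \<psi>(2)[of "h (\<Lambda> i) i" "\<Lambda> j" "h (\<Lambda> j) j"] hj[OF ij(1)] hj[OF ij(2)] True by simp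
    next
      case False
      then have "i \<noteq> j" by auto
      then show ?thesis
        using KG_span_orthogonal[OF \<psi>(1)[OF hj[OF ij(1)]] \<psi>(1)[OF hj[OF ij(2)]] False] by simp
    qed
  qed
qed

section \<open>The eigenvalue bound\<close>

lemma Ine_eq: "Ine D = (INF a. moment D a)"
  by (simp add: Ine_def moment_def)

context
  fixes D :: "('a::euclidean_space) set"
  assumes D: "bounded D" "open D" and nonempty: "D \<noteq> {}"
begin

lemma Vol_pos: "Vol D > 0"
proof -
  obtain x e where "e > 0" "ball x e \<subseteq> D" using D(2) nonempty openE by blast
  then have "0 < emeasure lborel (ball x e)" "emeasure lborel (ball x e) \<le> emeasure lborel D"
    using D(2) by (simp add: emeasure_ball_unit_ball_vol, intro emeasure_mono) auto
  then show ?thesis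
    using emeasure_D[OF D] by (simp add: Vol_def measure_def enn2real_positive_iff)
qed

lemma Ine_lower:
  assumes "r \<ge> 0" and "unit_ball_vol DIM('a) * r ^ DIM('a) \<le> Vol D / 2"
  shows "r\<^sup>2 * (Vol D / 2) \<le> Ine D"
  unfolding Ine_eq by (rule cINF_greatest) (simp, rule moment_lower[OF D assms])

text \<open>The estimate for each centre \<open>a\<close> is solved for \<open>moment D a\<close>.
  This yields a lower bound independent of \<open>a\<close>, which passes to the infimum without a
  minimiser.\<close>

lemma fourier_density_lipschitz:
  assumes J: "finite J" and u: "\<And>j. j \<in> J \<Longrightarrow> u j \<in> L2 D"
    and on: "\<And>i j. i \<in> J \<Longrightarrow> j \<in> J \<Longrightarrow> L2_inner (u i) (u j) = (if i = j then 1 else 0)"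
  shows "\<bar>(\<Sum>j\<in>J. (cmod (fourier (u j) \<xi>))\<^sup>2) - (\<Sum>j\<in>J. (cmod (fourier (u j) \<eta>))\<^sup>2)\<bar>
    \<le> 2 * (2 * pi) powr (- real DIM('a)) * sqrt (Vol D * Ine D) * norm (\<xi> - \<eta>)"
proof (cases "\<xi> = \<eta>")
  case False
  define c where "c = 2 * (2 * pi) powr (- real DIM('a)) * norm (\<xi> - \<eta>)"
  define L where "L = \<bar>(\<Sum>j\<in>J. (cmod (fourier (u j) \<xi>))\<^sup>2) - (\<Sum>j\<in>J. (cmod (fourier (u j) \<eta>))\<^sup>2)\<bar>"
  have c: "c > 0" using False by (simp add: c_def)
  have "(L / c)\<^sup>2 / Vol D \<le> Ine D"
    unfolding Ine_eq
  proof (rule cINF_greatest)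
    fix a
    have m: "0 \<le> Vol D * moment D a"
      using Vol_pos by (auto simp: moment_eq[OF D] intro!: mult_nonneg_nonneg integral_nonneg_AE)
    have "L \<le> c * sqrt (Vol D * moment D a)"
      unfolding L_def c_def using fourier_density_lipschitz_moment[OF D J u on, of \<xi> \<eta> a] by (simp add: mult_ac)
    then have "L / c \<le> sqrt (Vol D * moment D a)" using c by (simp add: field_simps)
    then have "(L / c)\<^sup>2 \<le> (sqrt (Vol D * moment D a))\<^sup>2"
      using c by (intro power_mono) (auto simp: L_def)
    then show "(L / c)\<^sup>2 / Vol D \<le> moment D a" by (simp only: pos_divide_le_eq[OF Vol_pos] mult.commute[of _ "Vol D"]) (use m in simp)
  qed auto
  then have "(L / c)\<^sup>2 \<le> Vol D * Ine D" by (simp only: pos_divide_le_eq[OF Vol_pos] mult.commute)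
  then have "L / c \<le> sqrt (Vol D * Ine D)" by (rule real_le_rsqrt)
  then show ?thesis using c unfolding L_def[symmetric] by (simp add: c_def field_simps)
qed simp

end

text \<open>The ball lies in the cube of side 2. This crude bound suffices for the ratio 2/3
  below.\<close>

lemma unit_ball_vol_le: "unit_ball_vol DIM('a::euclidean_space) \<le> 2 ^ DIM('a)"
proof -
  have sub: "ball (0::'a) 1 \<subseteq> cbox (- One) One"
  proof
    fix x :: 'a assume "x \<in> ball 0 1"
    then have "\<bar>x \<bullet> b\<bar> \<le> 1" if "b \<in> Basis" for b using Basis_le_norm[OF that, of x] by simp
    then show "x \<in> cbox (- One) One" by (auto simp: mem_box abs_le_iff minus_le_iff)
  qed
  have "ennreal (unit_ball_vol DIM('a)) = emeasure lborel (ball (0::'a) 1)"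
    by (simp add: emeasure_ball_unit_ball_vol)
  also have "\<dots> \<le> emeasure lborel (cbox (- One) (One::'a))" by (intro emeasure_mono sub) simp
  also have "\<dots> = ennreal (2 ^ DIM('a))"
  proof -
    have "(\<Prod>b\<in>Basis. (One - - One :: 'a) \<bullet> b) = (\<Prod>b\<in>(Basis::'a set). 2)"
      by (intro prod.cong) (auto simp: inner_add_left)
    then have "(\<Prod>b\<in>Basis. (One - - One :: 'a) \<bullet> b) = 2 ^ DIM('a)" by simp
    moreover have "emeasure lborel (cbox (- One) (One::'a)) = ennreal (\<Prod>b\<in>Basis. (One - - One :: 'a) \<bullet> b)"
      by (rule emeasure_lborel_cbox) simp
    ultimately show ?thesis by (simp only:)
  qed
  finally show ?thesis by simp
qed

text \<open>The ratio of the length scales \<open>M / \<rho>\<close> and \<open>R\<close> of the comparison argument stays below \<open>2 / 3\<close>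
  because half of the volume of \<open>D\<close> lies at distance at least \<open>r\<close> from any point.\<close>

lemma eigenvalue_sum_lower:
  fixes D :: "('a::euclidean_space) set" and R :: real
  assumes n: "DIM('a) \<ge> 2" and D: "bounded D" "open D" "D \<noteq> {}"
    and ev: "KG_eigenvalues D \<Lambda>" and k: "k \<ge> 1"
    and R: "R > 0" "unit_ball_vol DIM('a) * Vol D * R ^ DIM('a) = (2 * pi) ^ DIM('a) * k"
  shows "real k * (real DIM('a) / real (DIM('a) + 1) * R + Vol D / Ine D / (48 * real (DIM('a) + 1) * R)
      + (Vol D / Ine D)\<^sup>2 / (4608 * real (DIM('a) + 1) * R ^ 3)) \<le> (\<Sum>j=1..k. \<Lambda> j)" (is "?lhs \<le> _")
    and "Ine D > 0"
proof -
  let ?n = "DIM('a)" and ?w = "unit_ball_vol DIM('a)" and ?V = "Vol D" and ?I = "Ine D"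
  \<comment> \<open>The radius of a ball with half the volume of \<open>D\<close>.\<close>
  define r where "r = root ?n (?V / (2 * ?w))"
  have w: "?w > 0" by simp
  have V: "?V > 0" by (rule Vol_pos[OF D])
  have r: "r > 0" "?w * r ^ ?n = ?V / 2" using V w by (auto simp: r_def simp del: unit_ball_vol_pos)
  have I: "r\<^sup>2 * (?V / 2) \<le> ?I" using Ine_lower[OF D] r by simp
  show I0: "?I > 0" using less_le_trans[OF _ I] r V by simp
  \<comment> \<open>From \<open>Ine D \<ge> r^2 * Vol D / 2\<close> follows
    \<open>x^2 \<le> 1 / (2 * (r * R)^2)\<close>, and 9/8 is the threshold that turns this into
    4/9.\<close>
  have rR: "(r * R)\<^sup>2 \<ge> 9 / 8"
  proof (rule ccontr)
    assume "\<not> 9 / 8 \<le> (r * R)\<^sup>2"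
    then have lt: "((r * R)\<^sup>2) ^ ?n < (9 / 8) ^ ?n" by (intro power_strict_mono) auto
    \<comment> \<open>Multiplying the equations for \<open>r\<close> and \<open>R\<close> eliminates
      \<open>Vol D\<close>. With \<open>pi > 3\<close> and \<open>?w \<le> 2 ^ ?n\<close> this gives
      \<open>(3 / 2)^n \<le> 2 * (r * R)^n\<close>, whose square contradicts
      \<open>(r * R)^2 < 9 / 8\<close> as soon as \<open>2^n \<ge> 4\<close>.\<close>
    have "(?w * r ^ ?n) * (?w * ?V * R ^ ?n) = (?V / 2) * ((2 * pi) ^ ?n * k)" using r R by simp
    then have "(?V * 2) * (?w\<^sup>2 * (r * R) ^ ?n) = ?V * ((2 * pi) ^ ?n * k)"
      by (simp add: power2_eq_square power_mult_distrib mult_ac)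
    then have eq: "2 * (?w\<^sup>2 * (r * R) ^ ?n) = (2 * pi) ^ ?n * k" using V by simp
    have "(6::real) ^ ?n \<le> (2 * pi) ^ ?n" using pi_gt3 by (intro power_mono) auto
    also have "\<dots> \<le> (2 * pi) ^ ?n * k" using k by simp
    also have "\<dots> = 2 * (?w\<^sup>2 * (r * R) ^ ?n)" using eq by simp
    also have "\<dots> \<le> 2 * ((2 ^ ?n)\<^sup>2 * (r * R) ^ ?n)"
      using unit_ball_vol_le[where 'a='a] r R by (intro mult_left_mono mult_right_mono power_mono) auto
    finally have "(6::real) ^ ?n \<le> 2 * (4 ^ ?n * (r * R) ^ ?n)" by (simp add: power_mult[symmetric] mult.commute[of _ 2] power_mult)
    then have "(3 / 2 :: real) ^ ?n \<le> 2 * (r * R) ^ ?n"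
      using power_mult_distrib[of "4::real" "3 / 2" ?n] by simp
    then have "((3 / 2 :: real) ^ ?n)\<^sup>2 \<le> (2 * (r * R) ^ ?n)\<^sup>2" by (intro power_mono) auto
    also have "\<dots> = 4 * ((r * R)\<^sup>2) ^ ?n" by (simp add: power_mult_distrib power_mult[symmetric] mult.commute)
    also have "\<dots> < 4 * (9 / 8) ^ ?n" using lt by simp
    finally have "(9 / 4 :: real) ^ ?n < 4 * (9 / 8) ^ ?n"
      by (simp add: power_mult[symmetric] mult.commute[of _ 2]) (simp add: power_mult power_divide)
    moreover have "(9 / 4 :: real) ^ ?n = 2 ^ ?n * (9 / 8) ^ ?n" by (simp add: power_mult_distrib[symmetric])
    ultimately have "(2::real) ^ ?n < 4" by simp
    moreover have "(2::real) ^ 2 \<le> 2 ^ ?n" using n by (intro power_increasing) auto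
    ultimately show False by simp
  qed
  define M where "M = (2 * pi) powr (- real ?n) * ?V"
  define \<rho> where "\<rho> = 2 * (2 * pi) powr (- real ?n) * sqrt (?V * ?I)"
  define x where "x = sqrt (?V / ?I) / (2 * R)"
  have x0: "x \<ge> 0" using V I0 R by (simp add: x_def)
  have x2: "x\<^sup>2 = ?V / ?I / (4 * R\<^sup>2)" using V I0 by (simp add: x_def power_divide power_mult_distrib)
  have "x\<^sup>2 \<le> 4 / 9"
  proof -
    have "9 / 8 * (?V / 2) \<le> (r * R)\<^sup>2 * (?V / 2)" using rR V by (intro mult_right_mono) auto
    also have "\<dots> = (r\<^sup>2 * (?V / 2)) * R\<^sup>2" by (simp add: power_mult_distrib)
    also have "\<dots> \<le> ?I * R\<^sup>2" using I by (intro mult_right_mono) auto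
    finally show ?thesis unfolding x2 using I0 R by (simp add: field_simps)
  qed
  then have "x\<^sup>2 \<le> (2 / 3)\<^sup>2" by (simp add: power_divide)
  then have x1: "x \<le> 2 / 3" by (rule power2_le_imp_le) simp
  have M\<rho>: "M = \<rho> * (x * R)"
    using V I0 R by (simp add: M_def \<rho>_def x_def real_sqrt_mult real_sqrt_divide)
  have kM: "?w * M * R ^ ?n = k"
  proof -
    have "?w * M * R ^ ?n = (2 * pi) powr (- real ?n) * (?w * ?V * R ^ ?n)" by (simp add: M_def mult_ac)
    also have "\<dots> = ((2 * pi) powr (- real ?n) * (2 * pi) powr real ?n) * k" by (simp add: R(2) powr_realpow)
    finally show ?thesis by (simp flip: powr_add)
  qed
  obtain u where u: "\<And>j. 1 \<le> j \<Longrightarrow> u j \<in> KG_span D (\<Lambda> j)"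
    and on: "\<And>i j. 1 \<le> i \<Longrightarrow> 1 \<le> j \<Longrightarrow> L2_inner (u i) (u j) = (if i = j then 1 else 0)"
    using KG_orthonormal_eigenfunctions[OF ev] by metis
  have \<Lambda>: "\<Lambda> j > 0" if "1 \<le> j" for j
  proof -
    have "\<Lambda> 1 \<le> \<Lambda> j" using ev that by (auto simp: KG_eigenvalues_def mono_on_def)
    then show ?thesis using ev by (auto simp: KG_eigenvalues_def)
  qed
  have u2: "u j \<in> L2 D" if "1 \<le> j" for j using KG_span_L2[OF u[OF that]] .
  note u12 = L2_imp_L1_L2[OF D(1) u2]
  have sq1: "sqnorm (u j) = 1" if "1 \<le> j" for j
    using on[OF that that] unfolding L2_inner_self by simp
  define F where "F = (\<lambda>\<xi>. \<Sum>j\<in>{1..k}. (cmod (fourier (u j) \<xi>))\<^sup>2)"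
  have energy: "integrable lborel (\<lambda>\<xi>. norm \<xi> * (cmod (fourier (u j) \<xi>))\<^sup>2)"
    "(LINT \<xi>|lborel. norm \<xi> * (cmod (fourier (u j) \<xi>))\<^sup>2) = \<Lambda> j" if "1 \<le> j" for j
  proof -
    note e = KG_span_energy[OF D(1) u[OF that] \<Lambda>[OF that]]
    show "integrable lborel (\<lambda>\<xi>. norm \<xi> * (cmod (fourier (u j) \<xi>))\<^sup>2)" using e(1) by (simp add: KG.carrier_def)
    show "(LINT \<xi>|lborel. norm \<xi> * (cmod (fourier (u j) \<xi>))\<^sup>2) = \<Lambda> j"
      using e(2) unfolding KG_form_eq KG.form_self of_real_eq_iff by (simp add: sq1[OF that])
  qed
  have F_int: "integrable lborel F" unfolding F_def
    by (intro Bochner_Integration.integrable_sum fourier_sqnorm_le(1) u12) auto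
  have F_val: "(LINT \<xi>|lborel. F \<xi>) = k" unfolding F_def
  proof (subst Bochner_Integration.integral_sum)
    show "(\<Sum>j=1..k. sqnorm (fourier (u j))) = real k"
      using plancherel_L2[OF D(1) u2] sq1 by simp
  qed (use fourier_sqnorm_le(1)[OF u12] in auto)
  have nF: "norm \<xi> * F \<xi> = (\<Sum>j\<in>{1..k}. norm \<xi> * (cmod (fourier (u j) \<xi>))\<^sup>2)" for \<xi>
    by (simp add: F_def sum_distrib_left)
  have nF_int: "integrable lborel (\<lambda>\<xi>. norm \<xi> * F \<xi>)"
    unfolding nF by (intro Bochner_Integration.integrable_sum energy) auto
  have nF_val: "(LINT \<xi>|lborel. norm \<xi> * F \<xi>) = (\<Sum>j=1..k. \<Lambda> j)"
    unfolding nF by (subst Bochner_Integration.integral_sum) (use energy in auto)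
  have "real k * (real ?n / (?n + 1) * R + R / (?n + 1) * (x\<^sup>2 / 12 + x ^ 4 / 288)) \<le> (\<Sum>j=1..k. \<Lambda> j)"
    unfolding nF_val[symmetric] kM[symmetric]
  proof (rule lipschitz_bathtub[where \<rho> = \<rho>])
    show "F \<xi> \<le> M" for \<xi>
      unfolding F_def M_def by (rule fourier_density_bound[OF D(1,2)]) (use u2 on in auto)
    show "\<bar>F \<xi> - F \<eta>\<bar> \<le> \<rho> * norm (\<xi> - \<eta>)" for \<xi> \<eta>
      unfolding F_def \<rho>_def by (rule fourier_density_lipschitz[OF D]) (use u2 on in auto)
    show "?w * M * R ^ ?n \<le> (LINT \<xi>|lborel. F \<xi>)" by (simp add: kM F_val)
    show "M \<ge> 0" "\<rho> \<ge> 0" using V I0 by (auto simp: M_def \<rho>_def)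
  qed (use n F_int nF_int R x0 x1 M\<rho> in \<open>auto simp: F_def intro!: sum_nonneg\<close>)
  \<comment> \<open>Substituting \<open>x^2\<close> and \<open>x^4\<close> produces 4 * 12 = 48 and
    16 * 288 = 4608.\<close>
  moreover have "R / (?n + 1) * (x\<^sup>2 / 12 + x ^ 4 / 288) =
      ?V / ?I / (48 * real (?n + 1) * R) + (?V / ?I)\<^sup>2 / (4608 * real (?n + 1) * R ^ 3)"
  proof -
    have x4: "x ^ 4 = (?V / ?I)\<^sup>2 / (16 * R ^ 4)"
      using arg_cong[OF x2, of "\<lambda>y. y\<^sup>2"] by (simp add: power_divide power_mult_distrib flip: power_mult)
    have "R / N * (q / (4 * R\<^sup>2) / 12 + q\<^sup>2 / (16 * R ^ 4) / 288) = q / (48 * N * R) + q\<^sup>2 / (4608 * N * R ^ 3)"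
      if "N > 0" for N q :: real
      using R that by (simp add: field_simps power_numeral_reduce)
    from this[of "real (?n + 1)" "?V / ?I"] show ?thesis unfolding x2 x4 by linarith
  qed
  ultimately show "?lhs \<le> (\<Sum>j=1..k. \<Lambda> j)" by (simp only: add.assoc)
qed

theorem corollary1p1:
  fixes D :: "(real ^ 'n) set" and \<Lambda> :: "nat \<Rightarrow> real" and n k :: nat and \<omega> :: real
  defines "n \<equiv> CARD('n)"
    and "\<omega> \<equiv> Vol (ball (0 :: real ^ 'n) 1)"
  assumes "n \<ge> 2"
    and "domain D" and "bounded D" and "piecewise_smooth_boundary D"
    and "KG_eigenvalues D \<Lambda>"
    and "k \<ge> 1"
  shows "1 / real k * (\<Sum>j=1..k. \<Lambda> j) \<ge>
      real n / (real n + 1) * ((2 * pi) / (\<omega> * Vol D) powr (1 / real n)) * real k powr (1 / real n)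
    + 1 / (48 * (real n + 1)) * ((2 * pi) powr (-1) / (\<omega> * Vol D) powr (- 1 / real n))
        * (Vol D / Ine D) * real k powr (- 1 / real n)
    + (real n - 1)\<^sup>2 / (C_const n * real n * (real n + 1)\<^sup>2)
        * ((2 * pi) powr (-3) / (\<omega> * Vol D) powr (- 3 / real n))
        * (Vol D / Ine D)\<^sup>2 * real k powr (- 3 / real n)"
proof -
  have dim: "DIM(real ^ 'n) = n" by (simp add: n_def)
  have n2: "DIM(real ^ 'n) \<ge> 2" using assms(3) by (simp add: n_def)
  have D: "bounded D" "open D" "D \<noteq> {}" using assms by (auto simp: Defs.domain_def)
  have w: "\<omega> = unit_ball_vol n"
    using emeasure_ball_unit_ball_vol[of 1 "0 :: real ^ 'n"] by (simp add: \<omega>_def Vol_def measure_def n_def)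
  then have w0: "\<omega> > 0" by simp
  have V: "Vol D > 0" by (rule Vol_pos[OF D])
  \<comment> \<open>With \<open>b\<close> and \<open>c\<close> as \<open>n\<close>-th roots, every
    power in the claim is rational in \<open>b\<close>, \<open>c\<close> and \<open>2 * pi\<close>,
    and the three terms become multiples of \<open>R\<close>, \<open>1 / R\<close> and
    \<open>1 / R ^ 3\<close>.\<close>
  define b where "b = (\<omega> * Vol D) powr (1 / real n)"
  define c where "c = real k powr (1 / real n)"
  define R where "R = 2 * pi * c / b"
  have b: "b > 0" "b ^ n = \<omega> * Vol D"
    using w0 V assms(3) by (auto simp: b_def powr_realpow[symmetric] powr_powr)
  have c: "c > 0" "c ^ n = k"
    using assms(3,8) by (auto simp: c_def powr_realpow[symmetric] powr_powr)
  have R: "R > 0" "\<omega> * Vol D * R ^ n = (2 * pi) ^ n * k"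
    using b c w0 V by (auto simp: R_def power_divide power_mult_distrib)
  define q where "q = Vol D / Ine D"
  have main: "real k * (real n / (real n + 1) * R + q / (48 * (real n + 1) * R) + q\<^sup>2 / (4608 * (real n + 1) * R ^ 3))
      \<le> (\<Sum>j=1..k. \<Lambda> j)"
    using eigenvalue_sum_lower(1)[OF n2 D assms(7,8) R(1)] R(2) unfolding q_def dim w by (simp add: add.commute)
  have pw: "(\<omega> * Vol D) powr (- 1 / real n) = 1 / b" "(\<omega> * Vol D) powr (- 3 / real n) = 1 / b ^ 3"
    "real k powr (- 1 / real n) = 1 / c" "real k powr (- 3 / real n) = 1 / c ^ 3"
    "(2 * pi) powr (-1) = 1 / (2 * pi)" "(2 * pi) powr (-3) = 1 / (2 * pi) ^ 3"
  proof -
    have neg: "z powr (-1) = 1 / z" "z powr (-3) = 1 / z ^ 3" if "z > 0" for z :: real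
      using that by (simp_all add: powr_minus_divide powr_numeral)
    have "y powr (- 1 / real n) = (y powr (1 / real n)) powr (-1)"
      "y powr (- 3 / real n) = (y powr (1 / real n)) powr (-3)" for y
      unfolding powr_powr by simp_all
    then show "(\<omega> * Vol D) powr (- 1 / real n) = 1 / b" "(\<omega> * Vol D) powr (- 3 / real n) = 1 / b ^ 3"
      "real k powr (- 1 / real n) = 1 / c" "real k powr (- 3 / real n) = 1 / c ^ 3"
      "(2 * pi) powr (-1) = 1 / (2 * pi)" "(2 * pi) powr (-3) = 1 / (2 * pi) ^ 3"
      using neg b(1) c(1) pi_gt_zero unfolding b_def c_def by simp_all
  qed
  have t2: "1 / (48 * (real n + 1)) * ((2 * pi) powr (-1) / (\<omega> * Vol D) powr (- 1 / real n))
        * q * real k powr (- 1 / real n) = q / (48 * (real n + 1) * R)"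
    unfolding pw R_def using b(1) c(1) by (simp add: field_simps)
  have t3: "(real n - 1)\<^sup>2 / (C_const n * real n * (real n + 1)\<^sup>2)
        * ((2 * pi) powr (-3) / (\<omega> * Vol D) powr (- 3 / real n))
        * q\<^sup>2 * real k powr (- 3 / real n) \<le> q\<^sup>2 / (4608 * (real n + 1) * R ^ 3)"
  proof -
    have C: "C_const n \<ge> 4608" by (simp add: C_const_def)
    \<comment> \<open>Only \<open>C_const n \<ge> 4608\<close> and
      \<open>(n - 1)^2 \<le> n * (n + 1)\<close> enter, so the cases of \<open>C_const\<close> need
      no separate treatment.\<close>
    have "(real n - 1)\<^sup>2 * 4608 \<le> (real n * (real n + 1)) * C_const n"
      using assms(3) C by (intro mult_mono) (auto simp: power2_eq_square algebra_simps)
    then have "(real n - 1)\<^sup>2 * 4608 * (real n + 1) \<le> (real n * (real n + 1)) * C_const n * (real n + 1)"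
      by (intro mult_right_mono) auto
    then have "(real n - 1)\<^sup>2 * (4608 * (real n + 1)) \<le> C_const n * real n * (real n + 1)\<^sup>2"
      by (simp only: power2_eq_square mult_ac)
    moreover have "C_const n * real n * (real n + 1)\<^sup>2 > 0" using C assms(3) by (intro mult_pos_pos) auto
    moreover have "4608 * (real n + 1) > 0" by simp
    ultimately have "(real n - 1)\<^sup>2 / (C_const n * real n * (real n + 1)\<^sup>2) \<le> 1 / (4608 * (real n + 1))"
      by (simp only: pos_divide_le_eq pos_le_divide_eq times_divide_eq_left mult_1)
    then have "(real n - 1)\<^sup>2 / (C_const n * real n * (real n + 1)\<^sup>2) * (q\<^sup>2 / R ^ 3) \<le> 1 / (4608 * (real n + 1)) * (q\<^sup>2 / R ^ 3)"
      using R by (intro mult_right_mono) auto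
    moreover have "(2 * pi) powr (-3) / (\<omega> * Vol D) powr (- 3 / real n) * q\<^sup>2 * real k powr (- 3 / real n) = q\<^sup>2 / R ^ 3"
      unfolding pw R_def using b(1) c(1) by (simp add: power_divide power_mult_distrib)
    ultimately have "(real n - 1)\<^sup>2 / (C_const n * real n * (real n + 1)\<^sup>2) *
        ((2 * pi) powr (-3) / (\<omega> * Vol D) powr (- 3 / real n) * q\<^sup>2 * real k powr (- 3 / real n))
        \<le> 1 / (4608 * (real n + 1)) * (q\<^sup>2 / R ^ 3)"
      by (simp only:)
    also have "1 / (4608 * (real n + 1)) * (q\<^sup>2 / R ^ 3) = q\<^sup>2 / (4608 * (real n + 1) * R ^ 3)"
      by simp
    finally show ?thesis by (simp only: mult.assoc)
  qed
  have t1: "real n / (real n + 1) * ((2 * pi) / (\<omega> * Vol D) powr (1 / real n)) * real k powr (1 / real n) =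
      real n / (real n + 1) * R"
    unfolding b_def[symmetric] c_def[symmetric] R_def by simp
  have "real n / (real n + 1) * R + q / (48 * (real n + 1) * R) + q\<^sup>2 / (4608 * (real n + 1) * R ^ 3)
      \<le> 1 / real k * (\<Sum>j=1..k. \<Lambda> j)"
    using main assms(8) by (simp add: field_simps)
  then show ?thesis using t2 t3 unfolding t1 q_def[symmetric] by linarith
qed

end
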